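(* There exists a deterministic online algorithm for the fractional Online Submodular Assignment Problem that is $(1-\frac{1}{e})$-competitive: on every instance, the final value $\sum_{e\in E} v_e x_e$ of the fractional allocation it maintains is at least $(1-\frac{1}{e})\cdot \mathsf{OPT}$, where $\mathsf{OPT}$ is the optimal offline value defined below.
   Context: Fractional Online Submodular Assignment Problem (fractional online SAP). There is a finite ground set $E$ and a monotone submodular function $f:2^E\to\mathbb{R}_{\ge 0}$ with $f(\varnothing)=0$ and $f(\{e\})>0$ for all $e\in E$ (monotone: $f(A)\le f(B)$ for $A\subseteq B$; submodular: $f(A\cup B)\le f(A)+f(B)-f(A\cap B)$). Each element $e\in E$ has a value $v_e\ge 0$ and a cost $b_e>0$. The ground set is initially unknown and is partitioned into parts $Q_1,\dots,Q_m$ which arrive online one by one (in an order chosen by an adversary); upon arrival, $Q_j$ reveals its elements with their values and costs. The algorithm has an evaluation oracle for $f$ on any subset of elements revealed so far. When $Q_j$ arrives, the algorithm chooses values $x_e\ge 0$ for $e\in Q_j$; afterwards it may never increase these values but may decrease any $x_e$ at any time (free disposal). At all times the vector $x$ must satisfy $\sum_{e\in Q_j}x_e\le 1$ for every part $j$ and $\sum_{e\in S} b_e x_e\le f(S)$ for every $S\subseteq E$, $x\ge 0$. The objective is the final value of $\sum_{e\in E} v_e x_e$. $\mathsf{OPT}$ denotes the maximum of $\sum_{e\in E}v_ex_e$ over all $x\ge 0$ satisfying these constraints (the offline optimum, with all of $E$ known in advance). *)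

theory Defs
  imports "HOL-Analysis.Analysis" "HOL-Library.Disjoint_Sets" "HOL-Library.FuncSet"
begin

text \<open>
  The list \<open>parts\<close> is in order of arrival, so quantifying over all instances also quantifies over
  all arrival orders chosen by the adversary.  Only the values of \<open>util\<close> on subsets of \<open>ground\<close> and
  the values of \<open>val\<close> and \<open>cost\<close> on \<open>ground\<close> are meaningful.
\<close>

record 'e sap =
  ground :: "'e set"
  parts :: "'e set list"
  util :: "'e set \<Rightarrow> real"
  val :: "'e \<Rightarrow> real"
  cost :: "'e \<Rightarrow> real"

definition submodular_on :: "'e set \<Rightarrow> ('e set \<Rightarrow> real) \<Rightarrow> bool" where
  "submodular_on E f \<longleftrightarrow> (\<forall>A B. A \<subseteq> E \<longrightarrow> B \<subseteq> E \<longrightarrow> f (A \<union> B) \<le> f A + f B - f (A \<inter> B))"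

definition sap_instance :: "'e sap \<Rightarrow> bool" where
  "sap_instance I \<longleftrightarrow>
     finite (ground I) \<and>
     partition_on (ground I) (set (parts I)) \<and> distinct (parts I) \<and>
     (\<forall>A \<subseteq> ground I. 0 \<le> util I A) \<and>
     mono_on (Pow (ground I)) (util I) \<and>
     submodular_on (ground I) (util I) \<and>
     util I {} = 0 \<and>
     (\<forall>e \<in> ground I. 0 < util I {e}) \<and>
     (\<forall>e \<in> ground I. 0 \<le> val I e) \<and>
     (\<forall>e \<in> ground I. 0 < cost I e)"

definition feasible :: "'e sap \<Rightarrow> ('e \<Rightarrow> real) \<Rightarrow> bool" where
  "feasible I x \<longleftrightarrow>
     (\<forall>e \<in> ground I. 0 \<le> x e) \<and>
     (\<forall>Q \<in> set (parts I). (\<Sum>e\<in>Q. x e) \<le> 1) \<and>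
     (\<forall>S \<subseteq> ground I. (\<Sum>e\<in>S. cost I e * x e) \<le> util I S)"

definition objective :: "'e sap \<Rightarrow> ('e \<Rightarrow> real) \<Rightarrow> real" where
  "objective I x = (\<Sum>e\<in>ground I. val I e * x e)"

text \<open>The supremum is a maximum: see \<open>OPT_attained\<close> below.\<close>

definition OPT :: "'e sap \<Rightarrow> real" where
  "OPT I = (SUP x \<in> Collect (feasible I). objective I x)"

definition arrived :: "'e sap \<Rightarrow> nat \<Rightarrow> 'e set" where
  "arrived I j = \<Union> (set (take j (parts I)))"

text \<open>
  Everything known after the arrival of the first \<open>j\<close> parts.  The functions are restricted to the
  revealed elements (and to sets of revealed elements), so nothing about later parts, not even
  their number, can be read off.
\<close>

definition revealed :: "'e sap \<Rightarrow> nat \<Rightarrow> 'e sap" where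
  "revealed I j =
     \<lparr> ground = arrived I j,
       parts = take j (parts I),
       util = restrict (util I) (Pow (arrived I j)),
       val = restrict (val I) (arrived I j),
       cost = restrict (cost I) (arrived I j) \<rparr>"

text \<open>
  A deterministic online algorithm is a function from the revealed information to the allocation
  held after the latest arrival.  Its earlier allocations need not be an input, since they are
  determined by prefixes of the revealed information.  Elements that have not arrived have \<open>x\<^sub>e = 0\<close>.
\<close>

type_synonym 'e sap_policy = "'e sap \<Rightarrow> 'e \<Rightarrow> real"

definition allocation :: "'e sap_policy \<Rightarrow> 'e sap \<Rightarrow> nat \<Rightarrow> 'e \<Rightarrow> real" where
  "allocation A I j e = (if e \<in> arrived I j then A (revealed I j) e else 0)"

text \<open>
  The rules of the game: the allocation is feasible at all times, and the value of an element that
  arrived earlier never increases (it may decrease, by free disposal).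
\<close>

definition online_algorithm :: "'e sap_policy \<Rightarrow> bool" where
  "online_algorithm A \<longleftrightarrow>
     (\<forall>I. sap_instance I \<longrightarrow>
        (\<forall>j \<le> length (parts I). feasible I (allocation A I j)) \<and>
        (\<forall>j < length (parts I). \<forall>e \<in> arrived I j.
            allocation A I (Suc j) e \<le> allocation A I j e))"

definition competitive :: "real \<Rightarrow> 'e sap_policy \<Rightarrow> bool" where
  "competitive c A \<longleftrightarrow>
     (\<forall>I. sap_instance I \<longrightarrow>
        objective I (allocation A I (length (parts I))) \<ge> c * OPT I)"

lemma feasible_le_1:
  assumes I: "sap_instance I" and x: "feasible I x" and e: "e \<in> ground I"
  shows "x e \<le> 1"
proof -
  have fin: "finite (ground I)" and un: "\<Union> (set (parts I)) = ground I"
    using I by (auto simp: sap_instance_def partition_on_def)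
  obtain Q where Q: "Q \<in> set (parts I)" "e \<in> Q" using e un by blast
  have QE: "Q \<subseteq> ground I" using Q un by blast
  have "x e \<le> (\<Sum>e\<in>Q. x e)"
    using Q QE x fin by (intro member_le_sum) (auto simp: feasible_def intro: finite_subset)
  also have "\<dots> \<le> 1" using x Q by (auto simp: feasible_def)
  finally show ?thesis .
qed

lemma OPT_attained:
  assumes I: "sap_instance I"
  obtains x where "feasible I x" "objective I x = OPT I"
    "\<And>y. feasible I y \<Longrightarrow> objective I y \<le> OPT I"
proof -
  let ?E = "ground I"
  have un: "\<Union> (set (parts I)) = ?E"
    using I by (auto simp: sap_instance_def partition_on_def)
  define B where "B = (\<lambda>e. if e \<in> ?E then {0..1::real} else {0})"
  define K where "K = PiE UNIV B \<inter> Collect (feasible I)"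
  have "compact (PiE UNIV B)"
    unfolding compactin_euclidean_iff [symmetric] euclidean_product_topology [symmetric]
    by (subst compactin_PiE) (auto simp: B_def)
  moreover have "closed (Collect (feasible I))"
    unfolding feasible_def Ball_def
    by (intro closed_Collect_conj closed_Collect_all closed_Collect_imp open_Collect_const
        closed_Collect_le continuous_intros continuous_on_product_coordinates)
  ultimately have K: "compact K" unfolding K_def by (rule compact_Int_closed)
  define t where "t = (\<lambda>(x::'a \<Rightarrow> real) e. if e \<in> ?E then x e else 0)"
  have t: "t x \<in> K" "objective I (t x) = objective I x" if x: "feasible I x" for x
  proof -
    have eq: "(\<Sum>e\<in>S. g e * t x e) = (\<Sum>e\<in>S. g e * x e)" if "S \<subseteq> ?E" for S and g :: "'a \<Rightarrow> real"
      using that by (intro sum.cong) (auto simp: t_def)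
    have eq1: "(\<Sum>e\<in>Q. t x e) = (\<Sum>e\<in>Q. x e)" if "Q \<in> set (parts I)" for Q
      using that un by (intro sum.cong) (auto simp: t_def)
    have "feasible I (t x)"
      using x eq eq1 by (auto simp: feasible_def t_def)
    moreover have "t x \<in> PiE UNIV B"
      using x feasible_le_1[OF I x] by (auto simp: t_def B_def feasible_def)
    ultimately show "t x \<in> K" by (simp add: K_def)
    show "objective I (t x) = objective I x"
      using eq[of ?E] by (simp add: objective_def)
  qed
  have "feasible I (\<lambda>e. 0)"
    using I by (auto simp: feasible_def sap_instance_def)
  then have "K \<noteq> {}" using t(1) by blast
  moreover have "continuous_on K (objective I)"
    unfolding objective_def
    by (intro continuous_intros) (auto intro: continuous_on_subset continuous_on_product_coordinates)
  ultimately obtain x where x: "x \<in> K" and max: "\<And>y. y \<in> K \<Longrightarrow> objective I y \<le> objective I x"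
    using continuous_attains_sup[OF K] by blast
  have fx: "feasible I x" using x by (simp add: K_def)
  have le: "objective I y \<le> objective I x" if "feasible I y" for y
    using max[OF t(1)[OF that]] t(2)[OF that] by simp
  have "OPT I = objective I x"
    unfolding OPT_def by (rule cSup_eq_maximum) (use fx le in auto)
  with fx le that show ?thesis by metis
qed

end

theory Submission
  imports Defs
begin

text \<open>
  For \<open>M\<^sub>t A y = max\<^sub>S\<^sub>\<subseteq>\<^sub>A (y S - t f S)\<close> (the excess), \<open>y A - M\<^sub>1 A y\<close> is the largest mass of a
  feasible vector below \<open>y\<close> supported on \<open>A\<close>.  Let \<open>P y\<close> integrate \<open>exp t M\<^sub>t A y / (e - 1)\<close> over
  \<open>t\<close> in \<open>[0, 1]\<close> and over all superlevel sets \<open>A\<close> of the density \<open>v / b\<close>.  An arriving part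
  chooses its virtual fractions \<open>x\<close> once and for all so as to maximise \<open>v x - P\<close>, and the
  allocation held is the greedy feasible truncation of the virtual one.  Greedy amounts are
  marginals of a submodular rank function, so they only decrease as elements arrive.

  Optimality of the choices, convexity and increasing differences of \<open>P\<close> telescope to
  \<open>v x\<^sup>* \<le> v x - P y + (P (y + s y\<^sup>*) - P y) / s\<close> for the final virtual load \<open>y\<close>, every feasible
  \<open>y\<^sup>* = b x\<^sup>*\<close> and small \<open>s > 0\<close>.  Since \<open>M\<^sub>t (y + s y\<^sup>*) \<le> M\<^sub>t\<^sub>-\<^sub>s y\<close>, letting \<open>s\<close> tend to \<open>0\<close> bounds
  the right-hand side by \<open>e / (e - 1)\<close> times the integral of \<open>M\<^sub>0 - M\<^sub>1\<close>, which is the value of the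
  truncation.
\<close>

section \<open>The excess of a vector over a scaled submodular function\<close>

definition excess :: "('e set \<Rightarrow> real) \<Rightarrow> ('e \<Rightarrow> real) \<Rightarrow> real \<Rightarrow> 'e set \<Rightarrow> real" where
  "excess f y t A = Max ((\<lambda>S. sum y S - t * f S) ` Pow A)"

lemma excess_ge: "finite A \<Longrightarrow> S \<subseteq> A \<Longrightarrow> sum y S - t * f S \<le> excess f y t A"
  unfolding excess_def by (intro Max_ge) auto

lemma excess_le:
  assumes "finite A" "\<And>S. S \<subseteq> A \<Longrightarrow> sum y S - t * f S \<le> c"
  shows "excess f y t A \<le> c"
  unfolding excess_def using assms by (subst Max_le_iff) auto

lemma excess_attained:
  assumes "finite A"
  obtains S where "S \<subseteq> A" "excess f y t A = sum y S - t * f S"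
proof -
  have "excess f y t A \<in> (\<lambda>S. sum y S - t * f S) ` Pow A"
    unfolding excess_def using assms by (intro Max_in) auto
  then show ?thesis using that by blast
qed

lemma excess_cong:
  assumes "\<And>S. S \<subseteq> A \<Longrightarrow> f S = f' S" "\<And>e. e \<in> A \<Longrightarrow> y e = y' e"
  shows "excess f y t A = excess f' y' t A"
proof -
  have "(\<lambda>S. sum y S - t * f S) ` Pow A = (\<lambda>S. sum y' S - t * f' S) ` Pow A"
    using assms by (intro image_cong refl arg_cong2[where f = minus] sum.cong arg_cong2[where f = times]) auto
  then show ?thesis by (simp add: excess_def)
qed

lemma excess_mono_set: "finite B \<Longrightarrow> A \<subseteq> B \<Longrightarrow> excess f y t A \<le> excess f y t B"
  by (intro excess_le excess_ge) (auto intro: finite_subset)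

lemma excess_empty [simp]: "f {} = 0 \<Longrightarrow> excess f y t {} = 0"
  by (simp add: excess_def)

lemma excess_zero:
  assumes "finite A" "\<And>e. e \<in> A \<Longrightarrow> 0 \<le> y e"
  shows "excess f y 0 A = sum y A"
proof (rule antisym)
  show "excess f y 0 A \<le> sum y A"
    using assms by (intro excess_le) (auto intro!: sum_mono2)
  show "sum y A \<le> excess f y 0 A"
    using excess_ge[OF assms(1), of A y 0 f] by simp
qed

lemma excess_null:
  assumes "finite A" "\<And>e. e \<in> A \<Longrightarrow> y e = 0" "\<And>S. S \<subseteq> A \<Longrightarrow> 0 \<le> f S" "f {} = 0" "0 \<le> t"
  shows "excess f y t A = 0"
proof (rule antisym)
  show "excess f y t A \<le> 0"
  proof (rule excess_le)
    fix S assume S: "S \<subseteq> A"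
    then have "sum y S = 0" using assms(2) by (intro sum.neutral) auto
    then show "sum y S - t * f S \<le> 0" using assms S by simp
  qed (use assms in auto)
  show "0 \<le> excess f y t A"
    using excess_ge[OF assms(1), of "{}" y t f] assms by simp
qed

text \<open>A maximum of functions affine in \<open>y\<close> is convex in \<open>y\<close>.\<close>

lemma excess_convex:
  assumes "finite A" "0 \<le> a" "a \<le> 1"
  shows "excess f (\<lambda>e. (1 - a) * y e + a * z e) t A
    \<le> (1 - a) * excess f y t A + a * excess f z t A"
proof (rule excess_le)
  fix S assume S: "S \<subseteq> A"
  have "(\<Sum>e\<in>S. (1 - a) * y e + a * z e) - t * f S
      = (1 - a) * (sum y S - t * f S) + a * (sum z S - t * f S)"
  proof -
    have "(\<Sum>e\<in>S. (1 - a) * y e + a * z e) = (1 - a) * sum y S + a * sum z S"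
      by (simp add: sum.distrib sum_distrib_left)
    then show ?thesis by (simp add: algebra_simps)
  qed
  also have "\<dots> \<le> (1 - a) * excess f y t A + a * excess f z t A"
    using assms S by (intro add_mono mult_left_mono excess_ge) auto
  finally show "(\<Sum>e\<in>S. (1 - a) * y e + a * z e) - t * f S \<le> \<dots>" .
qed (use assms in auto)

text \<open>On each \<open>S\<close> the added mass is at most \<open>s * f S\<close>, which is
  exactly what lowering the scale from \<open>t\<close> to \<open>t - s\<close> pays for.\<close>

lemma excess_shift:
  assumes "finite A" "\<And>S. S \<subseteq> A \<Longrightarrow> sum z S \<le> f S" "0 \<le> s"
  shows "excess f (\<lambda>e. y e + s * z e) t A \<le> excess f y (t - s) A"
proof (rule excess_le)
  fix S assume S: "S \<subseteq> A"
  have "(\<Sum>e\<in>S. y e + s * z e) - t * f S = sum y S + s * sum z S - t * f S"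
    by (simp add: sum.distrib sum_distrib_left)
  also have "\<dots> \<le> sum y S - (t - s) * f S"
    using mult_left_mono[OF assms(2)[OF S] assms(3)] by (simp add: algebra_simps)
  also have "\<dots> \<le> excess f y (t - s) A" using assms S by (intro excess_ge)
  finally show "(\<Sum>e\<in>S. y e + s * z e) - t * f S \<le> excess f y (t - s) A" .
qed (use assms in auto)

lemma continuous_on_Max_image:
  fixes g :: "'i \<Rightarrow> 'a :: topological_space \<Rightarrow> real"
  assumes "finite I" "I \<noteq> {}" "\<And>i. i \<in> I \<Longrightarrow> continuous_on U (g i)"
  shows "continuous_on U (\<lambda>x. Max ((\<lambda>i. g i x) ` I))"
  using assms
proof (induction I rule: finite_ne_induct)
  case (insert i F)
  then show ?case by (auto intro!: continuous_intros)
qed auto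

lemma continuous_on_excess:
  fixes y :: "'a :: topological_space \<Rightarrow> 'e \<Rightarrow> real"
  assumes "finite A" "\<And>e. e \<in> A \<Longrightarrow> continuous_on U (\<lambda>x. y x e)" "continuous_on U t"
  shows "continuous_on U (\<lambda>x. excess f (y x) (t x) A)"
  unfolding excess_def using assms
  by (intro continuous_on_Max_image continuous_intros) auto

section \<open>Supermodularity and increasing differences of the excess\<close>

locale submodular_function =
  fixes E :: "'e set" and f :: "'e set \<Rightarrow> real"
  assumes finite_E: "finite E"
    and f_empty: "f {} = 0"
    and f_mono: "A \<subseteq> B \<Longrightarrow> B \<subseteq> E \<Longrightarrow> f A \<le> f B"
    and f_submod: "A \<subseteq> E \<Longrightarrow> B \<subseteq> E \<Longrightarrow> f (A \<union> B) + f (A \<inter> B) \<le> f A + f B"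
begin

lemma finite_sub: "A \<subseteq> E \<Longrightarrow> finite A"
  using finite_E finite_subset by blast

lemma f_nonneg: "A \<subseteq> E \<Longrightarrow> 0 \<le> f A"
  using f_mono[of "{}" A] f_empty by simp

text \<open>Topkis: maximising a jointly supermodular function over one argument preserves supermodularity.\<close>

lemma excess_topkis:
  assumes AB: "A \<subseteq> E" "B \<subseteq> E" and t: "0 \<le> t"
    and le: "\<And>S T. S \<subseteq> A \<Longrightarrow> T \<subseteq> B \<Longrightarrow> sum p S + sum q T \<le> sum p' (S \<inter> T) + sum q' (S \<union> T)"
  shows "excess f p t A + excess f q t B \<le> excess f p' t (A \<inter> B) + excess f q' t (A \<union> B)"
proof -
  obtain S where S: "S \<subseteq> A" "excess f p t A = sum p S - t * f S"
    using excess_attained[OF finite_sub[OF AB(1)]] .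
  obtain T where T: "T \<subseteq> B" "excess f q t B = sum q T - t * f T"
    using excess_attained[OF finite_sub[OF AB(2)]] .
  have "t * (f (S \<union> T) + f (S \<inter> T)) \<le> t * (f S + f T)"
    using S T AB t by (intro mult_left_mono f_submod) auto
  then have "excess f p t A + excess f q t B
      \<le> (sum p' (S \<inter> T) - t * f (S \<inter> T)) + (sum q' (S \<union> T) - t * f (S \<union> T))"
    using le[OF S(1) T(1)] S T by (simp add: algebra_simps)
  also have "\<dots> \<le> excess f p' t (A \<inter> B) + excess f q' t (A \<union> B)"
    using S T AB by (intro add_mono excess_ge) (auto intro!: finite_sub)
  finally show ?thesis .
qed

text \<open>Modular sums satisfy the hypothesis of \<open>excess_topkis\<close> with equality.
  Greedy marginals of the excess therefore grow with the set.\<close>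

lemma excess_supermodular:
  assumes "A \<subseteq> E" "B \<subseteq> E" "0 \<le> t"
  shows "excess f y t A + excess f y t B \<le> excess f y t (A \<inter> B) + excess f y t (A \<union> B)"
proof (rule excess_topkis)
  fix S T assume "S \<subseteq> A" "T \<subseteq> B"
  then have "finite S" "finite T" using assms by (auto intro!: finite_sub)
  then show "sum y S + sum y T \<le> sum y (S \<inter> T) + sum y (S \<union> T)"
    using sum.union_inter[of S T y] by simp
qed (use assms in auto)

text \<open>Of maximisers \<open>S\<close> for \<open>u + d\<close> and \<open>T\<close> for
  \<open>w\<close>, the elements of \<open>S - T\<close> pass from \<open>u\<close> to the larger
  \<open>w\<close>, while \<open>d\<close> is collected on \<open>S \<union> T\<close> instead of
  \<open>S\<close>.\<close>

lemma excess_incr_diff: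
  assumes A: "A \<subseteq> E" and t: "0 \<le> t"
    and uw: "\<And>e. e \<in> A \<Longrightarrow> u e \<le> w e" and d: "\<And>e. e \<in> A \<Longrightarrow> 0 \<le> d e"
  shows "excess f (\<lambda>e. u e + d e) t A + excess f w t A
    \<le> excess f u t A + excess f (\<lambda>e. w e + d e) t A"
proof -
  have "excess f (\<lambda>e. u e + d e) t A + excess f w t A
      \<le> excess f u t (A \<inter> A) + excess f (\<lambda>e. w e + d e) t (A \<union> A)"
  proof (rule excess_topkis)
    fix S T assume ST: "S \<subseteq> A" "T \<subseteq> A"
    then have fin: "finite S" "finite T" using A by (auto intro!: finite_sub)
    have *: "sum g (S \<union> T) = sum g (S - T) + sum g T" "sum g S = sum g (S - T) + sum g (S \<inter> T)"
      for g :: "'e \<Rightarrow> real"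
      using fin sum.union_disjoint[of "S - T" T g] sum.Int_Diff[of S g T]
      by (auto simp: add.commute)
    have "sum u (S - T) \<le> sum w (S - T)" using ST by (intro sum_mono uw) auto
    moreover have "sum d S \<le> sum d (S \<union> T)"
      using fin ST d by (intro sum_mono2) auto
    ultimately show "(\<Sum>e\<in>S. u e + d e) + sum w T \<le> sum u (S \<inter> T) + (\<Sum>e\<in>S \<union> T. w e + d e)"
      using *[of u] *[of w] by (simp add: sum.distrib)
  qed (use A t in auto)
  then show ?thesis by simp
qed

text \<open>Removing elements without mass from \<open>S\<close> keeps \<open>sum y S\<close> and
  cannot raise \<open>f S\<close>. Elements that carry no load are thus invisible to the
  potential.\<close>

lemma excess_support:
  assumes A: "A \<subseteq> E" and t: "0 \<le> t" and y: "\<And>e. e \<in> A - B \<Longrightarrow> y e = 0"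
  shows "excess f y t (A \<inter> B) = excess f y t A"
proof (rule antisym)
  show "excess f y t (A \<inter> B) \<le> excess f y t A"
    using A by (intro excess_mono_set finite_sub) auto
  show "excess f y t A \<le> excess f y t (A \<inter> B)"
  proof (rule excess_le)
    fix S assume S: "S \<subseteq> A"
    have "sum y S = sum y (S \<inter> B)"
      using S A y by (intro sum.mono_neutral_right finite_sub) auto
    moreover have "t * f (S \<inter> B) \<le> t * f S"
      using S A t by (intro mult_left_mono f_mono) auto
    ultimately have "sum y S - t * f S \<le> sum y (S \<inter> B) - t * f (S \<inter> B)" by simp
    also have "\<dots> \<le> excess f y t (A \<inter> B)"
      using S A by (intro excess_ge finite_sub) auto
    finally show "sum y S - t * f S \<le> excess f y t (A \<inter> B)" .
  qed (use A in \<open>auto intro: finite_sub\<close>)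
qed

lemma excess_insert_le:
  assumes A: "insert a A \<subseteq> E" and t: "0 \<le> t" and y: "0 \<le> y a"
  shows "excess f y t (insert a A) \<le> excess f y t A + y a"
proof (rule excess_le)
  fix S assume S: "S \<subseteq> insert a A"
  have fin: "finite S" using S A by (intro finite_sub) auto
  have "sum y S \<le> sum y (S - {a}) + y a"
    using fin y by (cases "a \<in> S") (auto simp: sum.remove[of S a y])
  moreover have "t * f (S - {a}) \<le> t * f S"
    using S A t by (intro mult_left_mono f_mono) auto
  moreover have "sum y (S - {a}) - t * f (S - {a}) \<le> excess f y t A"
    using S A by (intro excess_ge finite_sub) auto
  ultimately show "sum y S - t * f S \<le> excess f y t A + y a" by linarith
qed (use A in \<open>auto intro: finite_sub\<close>)

end


section \<open>Smoothing the excess over the scale\<close>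

text \<open>The weight \<open>exp t / (exp 1 - 1)\<close> is a probability density on [0, 1]. A
  shift of \<open>t\<close> reproduces it up to a factor, which is where the constant e / (e - 1)
  comes from.\<close>

definition smoothed :: "('e set \<Rightarrow> real) \<Rightarrow> ('e \<Rightarrow> real) \<Rightarrow> 'e set \<Rightarrow> real" where
  "smoothed f y A = integral {0..1} (\<lambda>t. exp t * excess f y t A) / (exp 1 - 1)"

lemma exp1_gt_1: "(1::real) < exp 1"
  by simp

lemma continuous_on_exp_excess:
  "finite A \<Longrightarrow> continuous_on U (\<lambda>t. exp t * excess f y (t - s) A)"
  by (intro continuous_intros continuous_on_excess)

lemma integrable_exp_excess:
  "finite A \<Longrightarrow> (\<lambda>t. exp t * excess f y (t - s) A) integrable_on {a..b}"
  by (intro integrable_continuous_interval continuous_on_exp_excess)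

lemmas integrable_exp_excess0 = integrable_exp_excess[where s = 0, simplified]

lemma smoothed_cong:
  assumes "\<And>S. S \<subseteq> A \<Longrightarrow> f S = f' S" "\<And>e. e \<in> A \<Longrightarrow> y e = y' e"
  shows "smoothed f y A = smoothed f' y' A"
proof -
  have "excess f y t A = excess f' y' t A" for t
    using assms by (rule excess_cong)
  then show ?thesis by (simp add: smoothed_def)
qed

lemma smoothed_empty: "f {} = 0 \<Longrightarrow> smoothed f y {} = 0"
  by (simp add: smoothed_def)

lemma smoothed_null:
  assumes "finite A" "\<And>e. e \<in> A \<Longrightarrow> y e = 0" "\<And>S. S \<subseteq> A \<Longrightarrow> 0 \<le> f S" "f {} = 0"
  shows "smoothed f y A = 0"
proof -
  have "integral {0..1} (\<lambda>t. exp t * excess f y t A) = integral {0..1} (\<lambda>t::real. 0)"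
  proof (rule integral_cong)
    fix t :: real assume "t \<in> {0..1}"
    then have "excess f y t A = 0" using assms by (intro excess_null) auto
    then show "exp t * excess f y t A = 0" by simp
  qed
  then show ?thesis by (simp add: smoothed_def)
qed

lemma smoothed_convex:
  assumes "finite A" "0 \<le> a" "a \<le> 1"
  shows "smoothed f (\<lambda>e. (1 - a) * y e + a * z e) A \<le> (1 - a) * smoothed f y A + a * smoothed f z A"
proof -
  let ?g = "\<lambda>y t. exp t * excess f y t A"
  note int = integrable_exp_excess0[OF assms(1)]
  have "integral {0..1} (?g (\<lambda>e. (1 - a) * y e + a * z e))
      \<le> integral {0..1} (\<lambda>t. (1 - a) * ?g y t + a * ?g z t)"
  proof (intro integral_le int integrable_add integrable_on_mult_right)
    fix t :: real
    show "?g (\<lambda>e. (1 - a) * y e + a * z e) t \<le> (1 - a) * ?g y t + a * ?g z t"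
      using mult_left_mono[OF excess_convex[OF assms, of f y z t], of "exp t"]
      by (simp add: algebra_simps)
  qed
  also have "\<dots> = (1 - a) * integral {0..1} (?g y) + a * integral {0..1} (?g z)"
    using int by (subst integral_add) (auto intro!: integrable_on_mult_right)
  finally show ?thesis
    using exp1_gt_1 by (simp add: smoothed_def divide_simps)
qed

text \<open>The integrand is jointly continuous in the parameter and the scale, and the scale ranges
  over a compact interval. The existence of best responses rests on this.\<close>

lemma continuous_on_smoothed:
  fixes y :: "'a :: topological_space \<Rightarrow> 'e \<Rightarrow> real"
  assumes "finite A" "\<And>e. e \<in> A \<Longrightarrow> continuous_on U (\<lambda>x. y x e)"
  shows "continuous_on U (\<lambda>x. smoothed f (y x) A)"
proof -
  have "continuous_on (U \<times> cbox 0 1) (\<lambda>(x, t). exp t * excess f (y x) t A)"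
    unfolding case_prod_beta
  proof (intro continuous_intros continuous_on_excess assms(1))
    fix e assume "e \<in> A"
    show "continuous_on (U \<times> cbox 0 1) (\<lambda>p. y (fst p) e)"
      by (rule continuous_on_compose2[OF assms(2)[OF \<open>e \<in> A\<close>] continuous_on_fst[OF continuous_on_id]]) auto
  qed
  then have "continuous_on U (\<lambda>x. integral (cbox 0 1) (\<lambda>t. exp t * excess f (y x) t A))"
    by (rule integral_continuous_on_param)
  then show ?thesis
    unfolding smoothed_def using exp1_gt_1 by (intro continuous_intros) (auto simp: cbox_interval)
qed

lemma smoothed_shift:
  assumes "finite A" "\<And>S. S \<subseteq> A \<Longrightarrow> sum z S \<le> f S" "0 \<le> s"
  shows "smoothed f (\<lambda>e. y e + s * z e) A
    \<le> integral {0..1} (\<lambda>t. exp t * excess f y (t - s) A) / (exp 1 - 1)"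
  unfolding smoothed_def
  using exp1_gt_1
  by (intro divide_right_mono integral_le integrable_exp_excess integrable_exp_excess0 assms(1)
      mult_left_mono excess_shift[OF assms]) auto

text \<open>
  The substitution \<open>u = t - s\<close> moves the parameter into the limits of integration and a factor
  \<open>exp s\<close>.
\<close>

lemma has_derivative_shifted_exp_integral:
  fixes g :: "real \<Rightarrow> real"
  assumes g: "continuous_on UNIV g"
  shows "((\<lambda>s. integral {0..1} (\<lambda>t. exp t * g (t - s))) has_real_derivative
    integral {0..1} (\<lambda>t. exp t * g t) - exp 1 * g 1 + g 0) (at 0)"
proof -
  define h where "h = (\<lambda>u. exp u * g u)"
  have h: "continuous_on S h" for S
    unfolding h_def by (intro continuous_intros continuous_on_subset[OF g]) auto
  have int: "h integrable_on {a..b}" for a b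
    by (intro integrable_continuous_interval h)
  \<comment> \<open>The base point -1 lies below both limits \<open>- s\<close> and
    \<open>1 - s\<close> whenever |s| < 1, so one primitive serves both ends.\<close>
  define F where "F = (\<lambda>x. integral {-1..x} h)"
  have F: "(F has_real_derivative h x) (at x)" if "-1 < x" for x
  proof -
    have "(F has_real_derivative h x) (at x within {-1..x+1})"
      unfolding F_def using that by (intro integral_has_real_derivative h) auto
    moreover have "at x within {-1..x+1} = at x"
      using that by (intro at_within_interior) auto
    ultimately show ?thesis by simp
  qed
  have eq: "integral {0..1} (\<lambda>t. exp t * g (t - s)) = exp s * (F (1 - s) - F (- s))"
    if "-1 < s" "s < 1" for s
  proof -
    have "integral {0..1} (\<lambda>t. exp t * g (t - s)) = integral {0..1} ((\<lambda>u. exp s * h u) \<circ> (\<lambda>t. t + (- s)))"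
      by (intro integral_cong) (simp add: h_def mult.assoc[symmetric] flip: exp_add)
    also have "\<dots> = integral {0 + (- s)..1 + (- s)} (\<lambda>u. exp s * h u)"
      by (intro integral_shift continuous_intros h)
    also have "\<dots> = exp s * integral {-s..1-s} h" by simp
    also have "integral {-s..1-s} h = F (1 - s) - F (- s)"
      using Henstock_Kurzweil_Integration.integral_combine[of "-1" "-s" "1-s" h] that int
      by (simp add: F_def)
    finally show ?thesis .
  qed
  have "((\<lambda>s. exp s * (F (1 - s) - F (- s))) has_real_derivative
      (F 1 - F 0) - h 1 + h 0) (at 0)"
  proof -
    have 1: "((\<lambda>s. F (1 - s)) has_real_derivative h 1 * (-1)) (at 0)"
      by (rule DERIV_chain2[where f = F and g = "\<lambda>s. 1 - s"])
        (auto intro!: F derivative_eq_intros)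
    have 2: "((\<lambda>s. F (- s)) has_real_derivative h 0 * (-1)) (at 0)"
      by (rule DERIV_chain2[where f = F and g = "\<lambda>s. - s"])
        (auto intro!: F derivative_eq_intros)
    show ?thesis
      by (rule derivative_eq_intros 1 2 refl)+ simp
  qed
  moreover have "integral {0..1} h = F 1 - F 0"
    using eq[of 0] by (simp add: h_def)
  ultimately have "((\<lambda>s. exp s * (F (1 - s) - F (- s))) has_real_derivative
      integral {0..1} (\<lambda>t. exp t * g t) - exp 1 * g 1 + g 0) (at 0)"
    by (simp add: h_def)
  then show ?thesis
    by (rule has_field_derivative_transform_within_open[where S = "{-1<..<1}"])
      (auto simp: eq)
qed

context submodular_function
begin

lemma smoothed_incr_diff:
  assumes A: "A \<subseteq> E" and uw: "\<And>e. e \<in> A \<Longrightarrow> u e \<le> w e" and d: "\<And>e. e \<in> A \<Longrightarrow> 0 \<le> d e"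
  shows "smoothed f (\<lambda>e. u e + d e) A + smoothed f w A
    \<le> smoothed f u A + smoothed f (\<lambda>e. w e + d e) A"
proof -
  let ?g = "\<lambda>y t. exp t * excess f y t A"
  note int = integrable_exp_excess0[OF finite_sub[OF A]]
  have "integral {0..1} (\<lambda>t. ?g (\<lambda>e. u e + d e) t + ?g w t)
      \<le> integral {0..1} (\<lambda>t. ?g u t + ?g (\<lambda>e. w e + d e) t)"
  proof (intro integral_le int integrable_add)
    fix t :: real assume "t \<in> {0..1}"
    then show "?g (\<lambda>e. u e + d e) t + ?g w t \<le> ?g u t + ?g (\<lambda>e. w e + d e) t"
      using mult_left_mono[OF excess_incr_diff[of A t u w d], of "exp t"] A uw d
      by (simp add: algebra_simps)
  qed
  then show ?thesis
    using int exp1_gt_1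
    by (simp add: smoothed_def integral_add divide_right_mono flip: add_divide_distrib)
qed

lemma smoothed_support:
  assumes "A \<subseteq> E" "\<And>e. e \<in> A - B \<Longrightarrow> y e = 0"
  shows "smoothed f y (A \<inter> B) = smoothed f y A"
proof -
  have "integral {0..1} (\<lambda>t. exp t * excess f y t (A \<inter> B)) = integral {0..1} (\<lambda>t. exp t * excess f y t A)"
  proof (rule integral_cong)
    fix t :: real assume "t \<in> {0..1}"
    then have "excess f y t (A \<inter> B) = excess f y t A" using assms by (intro excess_support) auto
    then show "exp t * excess f y t (A \<inter> B) = exp t * excess f y t A" by simp
  qed
  then show ?thesis by (simp add: smoothed_def)
qed

end

section \<open>Greedy sums along a linear order\<close>

text \<open>With \<open>(a, e) \<in> R\<close> read as \<open>a\<close> coming no later than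
  \<open>e\<close>, this is the prefix of \<open>E\<close> ending in \<open>e\<close>;
  \<open>marginal\<close> is the greedy increment along these prefixes.\<close>

definition below :: "('e \<times> 'e) set \<Rightarrow> 'e set \<Rightarrow> 'e \<Rightarrow> 'e set" where
  "below R E e = {a \<in> E. (a, e) \<in> R}"

definition marginal :: "('e \<times> 'e) set \<Rightarrow> 'e set \<Rightarrow> ('e set \<Rightarrow> real) \<Rightarrow> 'e \<Rightarrow> real" where
  "marginal R E \<phi> e = \<phi> (below R E e) - \<phi> (below R E e - {e})"

lemma finite_linear_order_max:
  assumes "linear_order R" "finite S" "S \<noteq> {}"
  shows "\<exists>m\<in>S. \<forall>a\<in>S. (a, m) \<in> R"
  using assms(2,3)
proof (induction S rule: finite_ne_induct)
  case (singleton x)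
  then show ?case using assms(1) by (auto simp: order_on_defs refl_on_def)
next
  case (insert x F)
  then obtain m where m: "m \<in> F" "\<forall>a\<in>F. (a, m) \<in> R" by blast
  have r: "refl R" "trans R" "total R" using assms(1) by (auto simp: order_on_defs)
  show ?case
  proof (cases "(x, m) \<in> R")
    case True
    with m show ?thesis by auto
  next
    case False
    moreover have "x \<noteq> m" using m(1) insert.hyps by blast
    ultimately have mx: "(m, x) \<in> R" using r(3) by (auto simp: total_on_def)
    have "(a, x) \<in> R" if "a \<in> insert x F" for a
      using that mx m(2) r(1,2) by (auto simp: refl_on_def dest: transD)
    then show ?thesis by blast
  qed
qed

text \<open>Telescoping: the last element \<open>m\<close> contributes
  \<open>\<phi> S - \<phi> (S - {m})\<close> and lies in no other element's prefix, so its removal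
  leaves those prefixes unchanged.\<close>

lemma sum_marginal:
  assumes R: "linear_order R" and S: "finite S"
  shows "(\<Sum>e\<in>S. marginal R S \<phi> e) = \<phi> S - \<phi> {}"
  using S
proof (induction S rule: finite_remove_induct)
  case (remove S)
  obtain m where m: "m \<in> S" "\<forall>a\<in>S. (a, m) \<in> R"
    using finite_linear_order_max[OF R remove(1,2)] by blast
  have "antisym R" using R by (auto simp: order_on_defs)
  then have "below R S e = below R (S - {m}) e" if "e \<in> S - {m}" for e
    using m that by (auto simp: below_def antisym_def)
  then have "(\<Sum>e\<in>S - {m}. marginal R S \<phi> e) = (\<Sum>e\<in>S - {m}. marginal R (S - {m}) \<phi> e)"
    by (intro sum.cong) (auto simp: marginal_def)
  also have "\<dots> = \<phi> (S - {m}) - \<phi> {}" using remove m by blast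
  finally have "(\<Sum>e\<in>S - {m}. marginal R S \<phi> e) = \<phi> (S - {m}) - \<phi> {}" .
  moreover have "below R S m = S" using m by (auto simp: below_def)
  ultimately show ?case
    using remove m by (simp add: sum.remove[of S m] marginal_def)
qed simp

text \<open>The weights are the gaps between consecutive elements of \<open>D\<close>, counted from
  0; a new maximum \<open>b\<close> receives the gap to the sum of the earlier weights.\<close>

lemma layer_weights_exist:
  fixes D :: "real set"
  assumes "finite D" "\<And>d. d \<in> D \<Longrightarrow> 0 \<le> d"
  shows "\<exists>c. (\<forall>d\<in>D. 0 \<le> c d) \<and> (\<forall>r\<in>D. (\<Sum>d | d \<in> D \<and> d \<le> r. c d) = r)"
  using assms
proof (induction D rule: finite_linorder_max_induct)
  case empty
  then show ?case by simp
next
  case (insert b D)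
  then obtain c where c: "\<forall>d\<in>D. 0 \<le> c d" "\<forall>r\<in>D. (\<Sum>d | d \<in> D \<and> d \<le> r. c d) = r"
    by auto
  have b: "b \<notin> D" using insert by auto
  have sum_c: "sum c D \<le> b"
  proof (cases "D = {}")
    case False
    then have M: "Max D \<in> D" using insert by auto
    have "{d. d \<in> D \<and> d \<le> Max D} = D" using insert by auto
    then have "sum c D = Max D" using c(2) M by metis
    then show ?thesis using insert M by force
  qed (use insert in simp)
  define c' where "c' = c(b := b - sum c D)"
  have c'_eq: "sum c' S = sum c S" if "b \<notin> S" for S
    using that by (intro sum.cong) (auto simp: c'_def)
  have "(\<Sum>d | d \<in> insert b D \<and> d \<le> r. c' d) = r" if r: "r \<in> insert b D" for r
  proof (cases "r = b")
    case True
    then have "{d. d \<in> insert b D \<and> d \<le> r} = insert b D" using insert by auto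
    then show ?thesis using True b insert c'_eq[of D] by (simp add: c'_def)
  next
    case False
    then have "{d. d \<in> insert b D \<and> d \<le> r} = {d. d \<in> D \<and> d \<le> r}" using insert r by force
    then show ?thesis using c(2) r False b by (simp add: c'_eq)
  qed
  moreover have "\<forall>d\<in>insert b D. 0 \<le> c' d" using c sum_c by (auto simp: c'_def)
  ultimately show ?case by blast
qed

text \<open>Layer-cake formula: a greedy sum is a positive combination of values at superlevel sets.\<close>

lemma sum_marginal_layers:
  assumes R: "linear_order R" and R\<rho>: "\<And>a b. (a, b) \<in> R \<Longrightarrow> \<rho> b \<le> \<rho> a"
    and E: "finite E" and D: "finite D"
    and c: "\<And>e. e \<in> E \<Longrightarrow> (\<Sum>d | d \<in> D \<and> d \<le> \<rho> e. c d) = \<rho> e"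
    and \<phi>: "\<phi> {} = 0"
  shows "(\<Sum>e\<in>E. \<rho> e * marginal R E \<phi> e) = (\<Sum>d\<in>D. c d * \<phi> {e \<in> E. d \<le> \<rho> e})"
proof -
  have "(\<Sum>e\<in>E. \<rho> e * marginal R E \<phi> e)
      = (\<Sum>e\<in>E. \<Sum>d\<in>D. if d \<le> \<rho> e then c d * marginal R E \<phi> e else 0)"
  proof (intro sum.cong refl)
    fix e assume "e \<in> E"
    then have "\<rho> e * marginal R E \<phi> e = (\<Sum>d | d \<in> D \<and> d \<le> \<rho> e. c d) * marginal R E \<phi> e"
      using c by simp
    also have "\<dots> = (\<Sum>d\<in>D. if d \<le> \<rho> e then c d * marginal R E \<phi> e else 0)"
      using D by (simp add: sum_distrib_right flip: sum.inter_filter)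
    finally show "\<rho> e * marginal R E \<phi> e = \<dots>" .
  qed
  also have "\<dots> = (\<Sum>d\<in>D. \<Sum>e\<in>E. if d \<le> \<rho> e then c d * marginal R E \<phi> e else 0)"
    by (rule sum.swap)
  also have "\<dots> = (\<Sum>d\<in>D. c d * \<phi> {e \<in> E. d \<le> \<rho> e})"
  proof (intro sum.cong refl)
    fix d assume "d \<in> D"
    let ?S = "{e \<in> E. d \<le> \<rho> e}"
    have "(\<Sum>e\<in>E. if d \<le> \<rho> e then c d * marginal R E \<phi> e else 0)
        = (\<Sum>e\<in>?S. c d * marginal R E \<phi> e)"
      using E by (simp add: sum.inter_filter)
    also have "\<dots> = (\<Sum>e\<in>?S. c d * marginal R ?S \<phi> e)"
    proof (intro sum.cong refl arg_cong2[where f = times])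
      fix e assume "e \<in> ?S"
      \<comment> \<open>Whatever precedes an element of a superlevel set is at least as dense, so
        the whole prefix lies in that set.\<close>
      then have "below R E e = below R ?S e" using R\<rho> by (force simp: below_def)
      then show "marginal R E \<phi> e = marginal R ?S \<phi> e" by (simp add: marginal_def)
    qed
    also have "\<dots> = c d * \<phi> ?S"
      using sum_marginal[OF R, of ?S \<phi>] E \<phi> by (simp flip: sum_distrib_left)
    finally show "(\<Sum>e\<in>E. if d \<le> \<rho> e then c d * marginal R E \<phi> e else 0) = c d * \<phi> ?S" .
  qed
  finally show ?thesis .
qed


text \<open>Two orders occur because the priority computed from a revealed instance is compared with
  the full one on arrived elements.\<close>

lemma marginal_cong:
  assumes "\<And>a. a \<in> E \<Longrightarrow> (a, e) \<in> R \<longleftrightarrow> (a, e) \<in> R'" "\<And>S. S \<subseteq> E \<Longrightarrow> \<phi> S = \<psi> S"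
  shows "marginal R E \<phi> e = marginal R' E \<psi> e"
proof -
  have "below R E e = below R' E e" using assms(1) by (auto simp: below_def)
  moreover have "below R' E e \<subseteq> E" "below R' E e - {e} \<subseteq> E" by (auto simp: below_def)
  ultimately show ?thesis using assms(2) by (simp add: marginal_def)
qed

context submodular_function
begin

text \<open>The excess is monotone in the set, and by \<open>excess_insert_le\<close> a new element
  raises it by at most its own mass. Truncation therefore leaves a value between 0 and the virtual
  one.\<close>

lemma marginal_excess_bounds:
  assumes "S \<subseteq> E" "0 \<le> t" "0 \<le> y e" "e \<in> S" "(e, e) \<in> R"
  shows "0 \<le> marginal R S (excess f y t) e" "marginal R S (excess f y t) e \<le> y e"
proof -
  have sub: "below R S e \<subseteq> E" using assms by (auto simp: below_def)
  have ins: "insert e (below R S e - {e}) = below R S e" using assms by (auto simp: below_def)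
  show "0 \<le> marginal R S (excess f y t) e"
    unfolding marginal_def using excess_mono_set[OF finite_sub[OF sub], of "below R S e - {e}" f y t]
    by auto
  show "marginal R S (excess f y t) e \<le> y e"
    unfolding marginal_def
    using excess_insert_le[of e "below R S e - {e}" t y] ins sub assms by auto
qed

text \<open>Supermodularity for the prefix in \<open>S\<close> and the prefix in \<open>T\<close>
  without \<open>e\<close>. That larger sets raise the amounts removed is the source of both
  feasibility and free disposal.\<close>

lemma marginal_excess_mono:
  assumes "S \<subseteq> T" "T \<subseteq> E" "0 \<le> t" "e \<in> S" "(e, e) \<in> R"
  shows "marginal R S (excess f y t) e \<le> marginal R T (excess f y t) e"
proof -
  have sub: "below R S e \<subseteq> E" "below R T e - {e} \<subseteq> E" using assms by (auto simp: below_def)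
  have "below R S e \<inter> (below R T e - {e}) = below R S e - {e}"
    "below R S e \<union> (below R T e - {e}) = below R T e"
    using assms by (auto simp: below_def)
  then show ?thesis
    using excess_supermodular[OF sub \<open>0 \<le> t\<close>, of y] by (simp add: marginal_def)
qed

end

section \<open>The best response of an arriving part\<close>

text \<open>Vectors live on the whole type but vanish off \<open>Q\<close>: the set is compact in
  the product topology, and an answer can be added to the allocation without disturbing other
  parts.\<close>

definition subdistributions :: "'e set \<Rightarrow> ('e \<Rightarrow> real) set" where
  "subdistributions Q = {x. (\<forall>e. 0 \<le> x e) \<and> (\<forall>e. e \<notin> Q \<longrightarrow> x e = 0) \<and> sum x Q \<le> 1}"

text \<open>Tychonoff: the set is a closed subset of a product of unit intervals and singletons
  \<open>{0}\<close>.\<close>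

lemma compact_subdistributions:
  assumes "finite Q"
  shows "compact (subdistributions Q)"
proof -
  define B where "B = (\<lambda>e. if e \<in> Q then {0..1::real} else {0})"
  have "compact (PiE UNIV B)"
    unfolding compactin_euclidean_iff [symmetric] euclidean_product_topology [symmetric]
    by (subst compactin_PiE) (auto simp: B_def)
  moreover have "closed {x. sum (x :: 'a \<Rightarrow> real) Q \<le> 1}"
    by (intro closed_Collect_le continuous_intros continuous_on_product_coordinates)
  ultimately have "compact (PiE UNIV B \<inter> {x. sum x Q \<le> 1})" by (rule compact_Int_closed)
  also have "PiE UNIV B \<inter> {x. sum x Q \<le> 1} = subdistributions Q"
  proof (intro equalityI subsetI)
    fix x assume x: "x \<in> subdistributions Q"
    have "x e \<le> 1" if "e \<in> Q" for e
      using member_le_sum[of e Q x] that x assms by (simp add: subdistributions_def)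
    with x show "x \<in> PiE UNIV B \<inter> {x. sum x Q \<le> 1}"
      by (auto simp: subdistributions_def B_def)
  next
    fix x assume "x \<in> PiE UNIV B \<inter> {x. sum x Q \<le> 1}"
    then have B: "x e \<in> B e" and le: "sum x Q \<le> 1" for e by auto
    have "0 \<le> x e" "e \<notin> Q \<Longrightarrow> x e = 0" for e
      using B[of e] by (auto simp: B_def split: if_splits)
    with le show "x \<in> subdistributions Q" by (simp add: subdistributions_def)
  qed
  finally show ?thesis .
qed

lemma subdistributions_convex:
  assumes "x \<in> subdistributions Q" "x' \<in> subdistributions Q" "0 \<le> a" "a \<le> 1"
  shows "(\<lambda>e. (1 - a) * x e + a * x' e) \<in> subdistributions Q"
proof -
  have "(\<Sum>e\<in>Q. (1 - a) * x e + a * x' e) = (1 - a) * sum x Q + a * sum x' Q"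
    by (simp add: sum.distrib sum_distrib_left)
  also have "\<dots> \<le> (1 - a) * 1 + a * 1"
    using assms by (intro add_mono mult_left_mono) (auto simp: subdistributions_def)
  finally show ?thesis using assms by (auto simp: subdistributions_def)
qed

section \<open>Density order, potential and response\<close>

definition dens :: "'e sap \<Rightarrow> 'e \<Rightarrow> real" where
  "dens I e = val I e / cost I e"

text \<open>One order of the whole element type, fixed before any instance is seen, so that ties are
  broken in the same way at every stage.\<close>

definition tie_break :: "('e \<times> 'e) set" where
  "tie_break = (SOME r. well_order r)"

definition priority :: "'e sap \<Rightarrow> ('e \<times> 'e) set" where
  "priority I = {(a, b). dens I b < dens I a \<or> dens I a = dens I b \<and> (a, b) \<in> tie_break}"

lemma linear_order_priority: "linear_order (priority I)"
proof -
  have "well_order (tie_break :: ('a \<times> 'a) set)"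
    unfolding tie_break_def by (rule someI_ex) (rule well_order_on)
  then have "refl (tie_break :: ('a \<times> 'a) set)" "trans (tie_break :: ('a \<times> 'a) set)"
    "antisym (tie_break :: ('a \<times> 'a) set)" "total (tie_break :: ('a \<times> 'a) set)"
    by (auto simp: order_on_defs)
  then have tb: "(a, a) \<in> tie_break" "(a, b) \<in> tie_break \<Longrightarrow> (b, c) \<in> tie_break \<Longrightarrow> (a, c) \<in> tie_break"
    "(a, b) \<in> tie_break \<Longrightarrow> (b, a) \<in> tie_break \<Longrightarrow> a = b"
    "(a, b) \<in> tie_break \<or> (b, a) \<in> tie_break" for a b c :: 'a
    by (auto simp: refl_on_def total_on_def dest: transD antisymD) metis
  have "refl (priority I)" using tb(1) by (auto simp: refl_on_def priority_def)
  moreover have "trans (priority I)"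
    by (rule transI) (auto simp: priority_def intro: tb(2))
  moreover have "antisym (priority I)"
    by (rule antisymI) (auto simp: priority_def intro: tb(3))
  moreover have "total (priority I)"
    using tb(4) by (auto simp: total_on_def priority_def)
  ultimately show ?thesis by (simp add: order_on_defs)
qed

lemma priority_refl: "(e, e) \<in> priority I"
  using linear_order_priority[of I] by (auto simp: order_on_defs refl_on_def)

text \<open>
  By \<open>sum_marginal_layers\<close> this is the integral of \<open>smoothed\<close> over the superlevel sets of the
  density; the greedy form does not refer to elements that have not arrived.
\<close>

definition potential :: "'e sap \<Rightarrow> ('e \<Rightarrow> real) \<Rightarrow> real" where
  "potential I y =
    (\<Sum>e\<in>ground I. dens I e * marginal (priority I) (ground I) (smoothed (util I) y) e)"

text \<open>The potential acts as a price for load: the arriving part is credited its value and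
  charged the potential of the total load.\<close>

definition surplus :: "'e sap \<Rightarrow> 'e set \<Rightarrow> ('e \<Rightarrow> real) \<Rightarrow> ('e \<Rightarrow> real) \<Rightarrow> real" where
  "surplus I Q x0 x = (\<Sum>e\<in>Q. val I e * x e) - potential I (\<lambda>e. cost I e * (x0 e + x e))"

text \<open>Choice fixes one maximiser for each argument, which makes the algorithm
  deterministic.\<close>

definition response :: "'e sap \<Rightarrow> 'e set \<Rightarrow> ('e \<Rightarrow> real) \<Rightarrow> 'e \<Rightarrow> real" where
  "response I Q x0 =
    (SOME x. x \<in> subdistributions Q \<and> (\<forall>x'\<in>subdistributions Q. surplus I Q x0 x' \<le> surplus I Q x0 x))"

lemma response:
  assumes "finite (ground I)" "finite Q"
  shows "response I Q x0 \<in> subdistributions Q"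
    "\<And>x. x \<in> subdistributions Q \<Longrightarrow> surplus I Q x0 x \<le> surplus I Q x0 (response I Q x0)"
proof -
  have "(\<lambda>e. 0) \<in> subdistributions Q" by (simp add: subdistributions_def)
  then have "subdistributions Q \<noteq> {}" by blast
  moreover have "continuous_on (subdistributions Q) (surplus I Q x0)"
  proof -
    have coord: "continuous_on (subdistributions Q) (\<lambda>x. x e)" for e
      by (rule continuous_on_subset[OF continuous_on_product_coordinates]) simp
    have "continuous_on (subdistributions Q) (\<lambda>x. smoothed (util I) (\<lambda>e. cost I e * (x0 e + x e)) A)"
      if "finite A" for A
      by (intro continuous_on_smoothed that continuous_on_mult_left continuous_on_add
          continuous_on_const coord)
    moreover have "finite (below R (ground I) e)" for R e
      using assms(1) by (simp add: below_def)
    ultimately show ?thesis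
      unfolding surplus_def potential_def marginal_def
      by (intro continuous_on_diff continuous_on_sum continuous_on_mult_left coord) simp_all
  qed
  ultimately have "\<exists>x. x \<in> subdistributions Q \<and> (\<forall>x'\<in>subdistributions Q. surplus I Q x0 x' \<le> surplus I Q x0 x)"
    using continuous_attains_sup[OF compact_subdistributions[OF assms(2)]] by blast
  from someI_ex[OF this]
  have *: "response I Q x0 \<in> subdistributions Q \<and>
      (\<forall>x'\<in>subdistributions Q. surplus I Q x0 x' \<le> surplus I Q x0 (response I Q x0))"
    unfolding response_def .
  then show "response I Q x0 \<in> subdistributions Q" by blast
  show "surplus I Q x0 x \<le> surplus I Q x0 (response I Q x0)" if "x \<in> subdistributions Q" for x
    using * that by blast
qed

section \<open>The inequality for a best response and its limit\<close>

context submodular_function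
begin

text \<open>Optimality is tested against \<open>(1 - s) * x + s * z\<close>. Convexity bounds
  \<open>P\<close> at the load without the share of \<open>z\<close>, and increasing differences
  move the increment caused by \<open>z\<close> up to the larger load \<open>W\<close>, where the
  increments of different parts can be added.\<close>

lemma best_response_gain:
  fixes c :: "'d \<Rightarrow> real" and L :: "'d \<Rightarrow> 'e set"
  assumes c: "\<And>d. d \<in> D \<Longrightarrow> 0 \<le> c d" and L: "\<And>d. L d \<subseteq> E"
    and P: "\<And>y. P y = (\<Sum>d\<in>D. c d * smoothed f y (L d))"
    and b: "\<And>e. e \<in> E \<Longrightarrow> 0 \<le> b e"
    and x: "x \<in> subdistributions Q" and z: "z \<in> subdistributions Q"
    and opt: "\<And>x'. x' \<in> subdistributions Q \<Longrightarrow>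
      (\<Sum>e\<in>Q. v e * x' e) - P (\<lambda>e. b e * (x0 e + x' e))
      \<le> (\<Sum>e\<in>Q. v e * x e) - P (\<lambda>e. b e * (x0 e + x e))"
    and s: "0 < s" "s \<le> 1"
    and W: "\<And>e. e \<in> E \<Longrightarrow> b e * (x0 e + x e) \<le> W e"
  shows "(\<Sum>e\<in>Q. v e * z e) \<le> (\<Sum>e\<in>Q. v e * x e)
    - (P (\<lambda>e. b e * (x0 e + x e)) - P (\<lambda>e. b e * x0 e))
    + (P (\<lambda>e. W e + s * (b e * z e)) - P W) / s"
proof -
  let ?old = "\<lambda>e. b e * x0 e" and ?y = "\<lambda>e. b e * (x0 e + x e)"
  \<comment> \<open>The test deviation produces the load \<open>?u + ?d\<close>: \<open>?u\<close>
    interpolates between the loads with and without \<open>x\<close>, and \<open>?d\<close> is the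
    share of \<open>z\<close>.\<close>
  let ?u = "\<lambda>e. (1 - s) * ?y e + s * ?old e" and ?d = "\<lambda>e. s * (b e * z e)"
  let ?x' = "\<lambda>e. (1 - s) * x e + s * z e"
  have "(\<Sum>e\<in>Q. v e * ?x' e) = (1 - s) * (\<Sum>e\<in>Q. v e * x e) + s * (\<Sum>e\<in>Q. v e * z e)"
    by (simp add: sum.distrib sum_distrib_left distrib_left mult.left_commute)
  moreover have "(\<lambda>e. b e * (x0 e + ?x' e)) = (\<lambda>e. ?u e + ?d e)"
    by (intro ext) (simp add: algebra_simps)
  ultimately have "(1 - s) * (\<Sum>e\<in>Q. v e * x e) + s * (\<Sum>e\<in>Q. v e * z e) - P (\<lambda>e. ?u e + ?d e)
      \<le> (\<Sum>e\<in>Q. v e * x e) - P ?y"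
    using opt[OF subdistributions_convex[OF x z, of s]] s by simp
  moreover have "P ?u \<le> (1 - s) * P ?y + s * P ?old"
  proof -
    have "P ?u \<le> (\<Sum>d\<in>D. c d * ((1 - s) * smoothed f ?y (L d) + s * smoothed f ?old (L d)))"
      unfolding P using s by (intro sum_mono mult_left_mono smoothed_convex c finite_sub L) auto
    also have "\<dots> = (1 - s) * P ?y + s * P ?old"
      by (simp add: P sum.distrib sum_distrib_left distrib_left mult.left_commute)
    finally show ?thesis .
  qed
  moreover have "P (\<lambda>e. ?u e + ?d e) + P W \<le> P ?u + P (\<lambda>e. W e + ?d e)"
  proof -
    have uW: "?u e \<le> W e" if "e \<in> E" for e
    proof -
      have "s * (b e * x e) \<ge> 0" using s b[OF that] x by (simp add: subdistributions_def)
      then have "?u e \<le> ?y e" by (simp add: algebra_simps)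
      then show ?thesis using W[OF that] by simp
    qed
    have d: "0 \<le> ?d e" if "e \<in> E" for e using s b[OF that] z by (simp add: subdistributions_def)
    have "(\<Sum>d\<in>D. c d * (smoothed f (\<lambda>e. ?u e + ?d e) (L d) + smoothed f W (L d)))
        \<le> (\<Sum>d\<in>D. c d * (smoothed f ?u (L d) + smoothed f (\<lambda>e. W e + ?d e) (L d)))"
      using L by (intro sum_mono mult_left_mono smoothed_incr_diff c uW d) auto
    then show ?thesis by (simp add: P distrib_left sum.distrib)
  qed
  ultimately have "s * (\<Sum>e\<in>Q. v e * z e) \<le> s * ((\<Sum>e\<in>Q. v e * x e) - (P ?y - P ?old))
      + (P (\<lambda>e. W e + ?d e) - P W)"
    by (simp add: algebra_simps)
  then show ?thesis using s by (simp add: field_simps)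
qed

text \<open>
  Moving by \<open>s\<close> times a feasible vector costs at most as much as lowering the scale by \<open>s\<close>; as \<open>s\<close>
  tends to \<open>0\<close> the rate of change is \<open>(\<integral> exp t M t - e M 1 + M 0) / (e - 1)\<close> with \<open>M\<close> the excess,
  and the integral cancels against \<open>P Y\<close>.
\<close>

lemma smoothed_limit_bound:
  fixes c :: "'d \<Rightarrow> real" and L :: "'d \<Rightarrow> 'e set"
  assumes D: "finite D" and c: "\<And>d. d \<in> D \<Longrightarrow> 0 \<le> c d" and L: "\<And>d. L d \<subseteq> E"
    and P: "\<And>y. P y = (\<Sum>d\<in>D. c d * smoothed f y (L d))"
    and z: "\<And>S. S \<subseteq> E \<Longrightarrow> sum z S \<le> f S" and y: "\<And>e. e \<in> E \<Longrightarrow> 0 \<le> y e"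
    and le: "\<And>s. 0 < s \<Longrightarrow> s \<le> 1 \<Longrightarrow>
      a \<le> (\<Sum>d\<in>D. c d * sum y (L d)) - P y + (P (\<lambda>e. y e + s * z e) - P y) / s"
  shows "(1 - 1 / exp 1) * a \<le> (\<Sum>d\<in>D. c d * (sum y (L d) - excess f y 1 (L d)))"
proof -
  define K where "K = (\<lambda>A s. integral {0..1} (\<lambda>t. exp t * excess f y (t - s) A))"
  define \<kappa> :: real where "\<kappa> = 1 / (exp 1 - 1)"
  have \<kappa>: "0 < \<kappa>" using exp1_gt_1 by (simp add: \<kappa>_def)
  have sm: "smoothed f y A = \<kappa> * K A 0" for A by (simp add: smoothed_def K_def \<kappa>_def)
  have fin: "finite (L d)" for d by (rule finite_sub[OF L])
  let ?M = "\<lambda>t d. excess f y t (L d)"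
  have lim: "((\<lambda>s. (K (L d) s - K (L d) 0) / s) \<longlongrightarrow> K (L d) 0 - exp 1 * ?M 1 d + ?M 0 d) (at_right 0)"
    for d
  proof -
    have "((\<lambda>s. K (L d) s) has_real_derivative K (L d) 0 - exp 1 * ?M 1 d + ?M 0 d) (at 0)"
      using has_derivative_shifted_exp_integral[of "\<lambda>t. ?M t d"] fin
      by (simp add: K_def continuous_on_excess)
    then have "((\<lambda>s. (K (L d) s - K (L d) 0) / s) \<longlongrightarrow> K (L d) 0 - exp 1 * ?M 1 d + ?M 0 d) (at 0)"
      by (simp add: has_field_derivative_iff)
    then show ?thesis by (rule tendsto_mono[OF at_le, rotated]) simp
  qed
  \<comment> \<open>\<open>R s\<close> is the assumed bound with the moved potential replaced by its
    estimate through \<open>K\<close>. As a finite sum of difference quotients it has a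
    limit.\<close>
  define R where "R = (\<lambda>s. \<Sum>d\<in>D. c d * (sum y (L d) - \<kappa> * K (L d) 0
    + \<kappa> * ((K (L d) s - K (L d) 0) / s)))"
  have "a \<le> R s" if s: "0 < s" "s \<le> 1" for s
  proof -
    have "P (\<lambda>e. y e + s * z e) \<le> (\<Sum>d\<in>D. c d * (\<kappa> * K (L d) s))"
      unfolding P
    proof (intro sum_mono mult_left_mono c)
      fix d
      show "smoothed f (\<lambda>e. y e + s * z e) (L d) \<le> \<kappa> * K (L d) s"
        using smoothed_shift[OF fin, of d z f s y] z order_trans[OF _ L, of _ d] s
        by (simp add: K_def \<kappa>_def)
    qed
    then have "(P (\<lambda>e. y e + s * z e) - P y) / s
        \<le> ((\<Sum>d\<in>D. c d * (\<kappa> * K (L d) s)) - (\<Sum>d\<in>D. c d * (\<kappa> * K (L d) 0))) / s"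
      using s by (intro divide_right_mono) (auto simp: P sm)
    also have "\<dots> = (\<Sum>d\<in>D. c d * (\<kappa> * ((K (L d) s - K (L d) 0) / s)))"
      unfolding sum_subtractf[symmetric] sum_divide_distrib
      by (intro sum.cong refl) (simp add: right_diff_distrib diff_divide_distrib)
    finally have "a \<le> (\<Sum>d\<in>D. c d * sum y (L d)) - P y
        + (\<Sum>d\<in>D. c d * (\<kappa> * ((K (L d) s - K (L d) 0) / s)))"
      using le[OF s] by linarith
    also have "\<dots> = R s"
      by (simp add: R_def P sm distrib_left right_diff_distrib sum.distrib sum_subtractf)
    finally show ?thesis .
  qed
  then have "eventually (\<lambda>s. a \<le> R s) (at_right 0)"
    unfolding eventually_at_right_field by (intro exI[of _ 1]) simp
  moreover have "(R \<longlongrightarrow> (\<Sum>d\<in>D. c d * (sum y (L d) - \<kappa> * K (L d) 0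
      + \<kappa> * (K (L d) 0 - exp 1 * ?M 1 d + ?M 0 d)))) (at_right 0)"
    unfolding R_def by (intro tendsto_intros lim)
  ultimately have "a \<le> (\<Sum>d\<in>D. c d * (sum y (L d) - \<kappa> * K (L d) 0
      + \<kappa> * (K (L d) 0 - exp 1 * ?M 1 d + ?M 0 d)))"
    by (intro tendsto_lowerbound) auto
  also have "\<dots> = (\<Sum>d\<in>D. (exp 1 * \<kappa>) * (c d * (sum y (L d) - ?M 1 d)))"
  proof (intro sum.cong refl)
    fix d
    \<comment> \<open>The integrals \<open>K (L d) 0\<close> cancel. Since \<open>?M 0 d\<close> is
      the whole mass, that mass gets the coefficient \<open>1 + \<kappa> = exp 1 * \<kappa>\<close>,
      the same as \<open>?M 1 d\<close> up to sign.\<close>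
    have "?M 0 d = sum y (L d)" using y L by (intro excess_zero fin) blast
    moreover have "1 + \<kappa> = exp 1 * \<kappa>" using exp1_gt_1 by (simp add: \<kappa>_def field_simps)
    moreover have "sum y (L d) - \<kappa> * K (L d) 0 + \<kappa> * (K (L d) 0 - exp 1 * ?M 1 d + ?M 0 d)
        = sum y (L d) + \<kappa> * ?M 0 d - exp 1 * \<kappa> * ?M 1 d"
      by (simp add: algebra_simps)
    moreover have "sum y (L d) + \<kappa> * sum y (L d) = (1 + \<kappa>) * sum y (L d)"
      by (simp add: algebra_simps)
    ultimately have "sum y (L d) - \<kappa> * K (L d) 0 + \<kappa> * (K (L d) 0 - exp 1 * ?M 1 d + ?M 0 d)
        = (exp 1 * \<kappa>) * (sum y (L d) - ?M 1 d)"
      by (simp add: right_diff_distrib)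
    then show "c d * (sum y (L d) - \<kappa> * K (L d) 0 + \<kappa> * (K (L d) 0 - exp 1 * ?M 1 d + ?M 0 d))
        = (exp 1 * \<kappa>) * (c d * (sum y (L d) - ?M 1 d))"
      by (simp add: mult.left_commute)
  qed
  also have "\<dots> = (exp 1 * \<kappa>) * (\<Sum>d\<in>D. c d * (sum y (L d) - ?M 1 d))"
    by (simp add: sum_distrib_left)
  finally have "a \<le> (exp 1 * \<kappa>) * (\<Sum>d\<in>D. c d * (sum y (L d) - ?M 1 d))" .
  then have "(1 - 1 / exp 1) * a
      \<le> (1 - 1 / exp 1) * ((exp 1 * \<kappa>) * (\<Sum>d\<in>D. c d * (sum y (L d) - ?M 1 d)))"
    by (intro mult_left_mono) auto
  also have "\<dots> = (\<Sum>d\<in>D. c d * (sum y (L d) - ?M 1 d))"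
  proof -
    have "(1 - 1 / exp 1) * (exp 1 * \<kappa>) = (exp 1 - 1) * \<kappa>"
      by (simp add: left_diff_distrib)
    also have "\<dots> = 1" using exp1_gt_1 by (simp add: \<kappa>_def)
    finally show ?thesis by (simp flip: mult.assoc)
  qed
  finally show ?thesis .
qed

end

section \<open>The online algorithm\<close>

text \<open>
  The virtual allocation of a part is never revised and may become infeasible; the allocation
  actually held is its greedy feasible truncation in order of priority.
\<close>

primrec virtual :: "'e sap \<Rightarrow> nat \<Rightarrow> 'e \<Rightarrow> real" where
  "virtual I 0 = (\<lambda>e. 0)"
| "virtual I (Suc j) =
    (\<lambda>e. virtual I j e + response (revealed I (Suc j)) (parts I ! j) (virtual I j) e)"

text \<open>In terms of the load \<open>y\<close> that \<open>x\<close> induces, what is kept is the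
  greedy marginal of the rank function that sends \<open>S\<close> to the minimum of
  \<open>f T + y (S - T)\<close> over \<open>T \<subseteq> S\<close>, divided by the cost to return
  to fractions.\<close>

definition truncated :: "'e sap \<Rightarrow> ('e \<Rightarrow> real) \<Rightarrow> 'e \<Rightarrow> real" where
  "truncated I x e =
    x e - marginal (priority I) (ground I) (excess (util I) (\<lambda>e. cost I e * x e) 1) e / cost I e"

text \<open>The virtual history is recomputed from the revealed instance, whose number of parts
  tells the current stage.\<close>

definition policy :: "'e sap_policy" where
  "policy I = truncated I (virtual I (length (parts I)))"

section \<open>Consistency of the revealed instances\<close>

lemma arrived_mono: "j \<le> k \<Longrightarrow> arrived I j \<subseteq> arrived I k"
  unfolding arrived_def by (intro Union_mono set_take_subset_set_take)

lemma arrived_revealed: "j \<le> k \<Longrightarrow> arrived (revealed I k) j = arrived I j"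
  by (simp add: arrived_def revealed_def min_absorb1)

lemma revealed_revealed:
  assumes "j \<le> k"
  shows "revealed (revealed I k) j = revealed I j"
proof -
  have "arrived I j \<subseteq> arrived I k" using assms by (rule arrived_mono)
  then show ?thesis
    unfolding revealed_def[of "revealed I k"] arrived_revealed[OF assms]
    using assms by (simp add: revealed_def min_absorb1 Int_absorb1 Pow_mono)
qed

text \<open>Each round reads only what is revealed by then, and by \<open>revealed_revealed\<close>
  the earlier stages can be rebuilt from stage \<open>k\<close>.\<close>

lemma virtual_revealed: "j \<le> k \<Longrightarrow> k \<le> length (parts I) \<Longrightarrow> virtual (revealed I k) j = virtual I j"
proof (induction j)
  case (Suc j)
  then have "parts (revealed I k) ! j = parts I ! j" by (simp add: revealed_def)
  with Suc show ?case by (simp add: revealed_revealed)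
qed simp

lemma marginal_sum:
  assumes "finite E" "e \<in> E" "(e, e) \<in> R"
  shows "marginal R E (sum y) e = y e"
proof -
  have "finite (below R E e)" "e \<in> below R E e" using assms by (auto simp: below_def)
  then show ?thesis by (simp add: marginal_def sum.remove)
qed

locale sap =
  fixes I :: "'e sap"
  assumes inst: "sap_instance I"
begin

sublocale submodular_function "ground I" "util I"
proof
  show "finite (ground I)" "util I {} = 0" using inst by (auto simp: sap_instance_def)
  show "util I A \<le> util I B" if "A \<subseteq> B" "B \<subseteq> ground I" for A B
    using inst that by (auto simp: sap_instance_def mono_on_def)
  show "util I (A \<union> B) + util I (A \<inter> B) \<le> util I A + util I B"
    if "A \<subseteq> ground I" "B \<subseteq> ground I" for A B
  proof -
    have "submodular_on (ground I) (util I)" using inst by (simp add: sap_instance_def)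
    then have "util I (A \<union> B) \<le> util I A + util I B - util I (A \<inter> B)"
      using that by (simp add: submodular_on_def)
    then show ?thesis by simp
  qed
qed

abbreviation num_parts :: nat where "num_parts \<equiv> length (parts I)"

abbreviation batch :: "nat \<Rightarrow> 'e set" where "batch j \<equiv> parts I ! j"

lemma cost_pos: "e \<in> ground I \<Longrightarrow> 0 < cost I e"
  using inst by (auto simp: sap_instance_def)

lemma dens_nonneg: "e \<in> ground I \<Longrightarrow> 0 \<le> dens I e"
  using inst by (auto simp: sap_instance_def dens_def intro!: divide_nonneg_pos)

lemma arrived_all: "arrived I num_parts = ground I"
  using inst by (simp add: arrived_def sap_instance_def partition_on_def)

lemma arrived_sub: "arrived I j \<subseteq> ground I"
  using inst set_take_subset[of j "parts I"]
  by (auto simp: arrived_def sap_instance_def partition_on_def)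

lemma arrived_Suc: "j < num_parts \<Longrightarrow> arrived I (Suc j) = arrived I j \<union> batch j"
  by (auto simp: arrived_def take_Suc_conv_app_nth)

lemma batch_sub: "j < num_parts \<Longrightarrow> batch j \<subseteq> ground I"
  using arrived_Suc[of j] arrived_sub[of "Suc j"] by blast

lemma batch_disjoint: "i < num_parts \<Longrightarrow> j < num_parts \<Longrightarrow> i \<noteq> j \<Longrightarrow> batch i \<inter> batch j = {}"
  using inst by (auto simp: sap_instance_def partition_on_def disjoint_def nth_eq_iff_index_eq)

lemma arrived_batch_disjoint:
  assumes "j < num_parts"
  shows "arrived I j \<inter> batch j = {}"
proof -
  have "e \<notin> batch j" if e: "e \<in> arrived I j" for e
  proof -
    obtain i where "i < j" "e \<in> batch i"
      using e assms by (auto simp: arrived_def in_set_conv_nth)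
    then show ?thesis using batch_disjoint[of i j] assms by auto
  qed
  then show ?thesis by blast
qed

abbreviation answer :: "nat \<Rightarrow> 'e \<Rightarrow> real" where
  "answer j \<equiv> response (revealed I (Suc j)) (batch j) (virtual I j)"

lemma ground_revealed: "ground (revealed I k) = arrived I k"
  by (simp add: revealed_def)

lemma finite_batches: "finite (ground (revealed I k))" "j < num_parts \<Longrightarrow> finite (batch j)"
  using finite_sub[OF arrived_sub] finite_sub[OF batch_sub] by (auto simp: ground_revealed)

lemma answer_mem: "j < num_parts \<Longrightarrow> answer j \<in> subdistributions (batch j)"
  by (rule response(1)[OF finite_batches])

lemma answer_optimal:
  "j < num_parts \<Longrightarrow> x \<in> subdistributions (batch j) \<Longrightarrow>
    surplus (revealed I (Suc j)) (batch j) (virtual I j) x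
    \<le> surplus (revealed I (Suc j)) (batch j) (virtual I j) (answer j)"
  by (rule response(2)[OF finite_batches])

lemma virtual_nonneg: "k \<le> num_parts \<Longrightarrow> 0 \<le> virtual I k e"
proof (induction k)
  case (Suc k)
  then show ?case using answer_mem[of k] by (auto simp: subdistributions_def)
qed simp

text \<open>Parts are disjoint and answers vanish off their part, so a fraction changes only in the
  round in which its element arrives.\<close>

lemma virtual_batch:
  assumes "i < num_parts" "k \<le> num_parts" "e \<in> batch i"
  shows "virtual I k e = (if i < k then answer i e else 0)"
  using assms(2)
proof (induction k)
  case (Suc k)
  have "answer k e = 0" if "k \<noteq> i"
    using answer_mem[of k] batch_disjoint[of k i] that Suc assms by (auto simp: subdistributions_def)
  then show ?case using Suc by (auto simp: less_Suc_eq)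
qed simp

lemma virtual_not_arrived:
  assumes "k \<le> num_parts" "e \<notin> arrived I k"
  shows "virtual I k e = 0"
  using assms
proof (induction k)
  case (Suc k)
  then show ?case using answer_mem[of k] arrived_Suc[of k] by (auto simp: subdistributions_def)
qed simp

lemma virtual_arrived:
  assumes "j \<le> k" "k \<le> num_parts" "e \<in> arrived I j"
  shows "virtual I k e = virtual I j e"
proof -
  obtain i where "i < j" "e \<in> batch i"
    using assms by (auto simp: arrived_def in_set_conv_nth)
  then show ?thesis using virtual_batch[of i j e] virtual_batch[of i k e] assms by auto
qed

section \<open>Feasibility and free disposal\<close>

abbreviation load :: "nat \<Rightarrow> 'e \<Rightarrow> real" where
  "load k \<equiv> \<lambda>e. cost I e * virtual I k e"

lemma load_nonneg: "k \<le> num_parts \<Longrightarrow> e \<in> ground I \<Longrightarrow> 0 \<le> load k e"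
  using virtual_nonneg[of k e] cost_pos[of e] by simp

lemma revealed_agree:
  shows "e \<in> arrived I k \<Longrightarrow> val (revealed I k) e = val I e"
    "e \<in> arrived I k \<Longrightarrow> cost (revealed I k) e = cost I e"
    "e \<in> arrived I k \<Longrightarrow> dens (revealed I k) e = dens I e"
    "S \<subseteq> arrived I k \<Longrightarrow> util (revealed I k) S = util I S"
  by (auto simp: revealed_def dens_def)

lemma priority_revealed:
  "a \<in> arrived I k \<Longrightarrow> e \<in> arrived I k \<Longrightarrow> (a, e) \<in> priority (revealed I k) \<longleftrightarrow> (a, e) \<in> priority I"
  by (simp add: priority_def revealed_agree)

text \<open>On arrived elements the revealed data and the order derived from them agree with the
  full instance, so all stages can be analysed with one order and one \<open>util\<close>.\<close>

lemma allocation_eq: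
  assumes k: "k \<le> num_parts" and e: "e \<in> arrived I k"
  shows "allocation policy I k e = virtual I k e
    - marginal (priority I) (arrived I k) (excess (util I) (load k) 1) e / cost I e"
proof -
  have "length (parts (revealed I k)) = k" using k by (simp add: revealed_def)
  then have "allocation policy I k e = truncated (revealed I k) (virtual I k) e"
    using e k by (simp add: allocation_def policy_def virtual_revealed)
  also have "marginal (priority (revealed I k)) (arrived I k)
        (excess (util (revealed I k)) (\<lambda>e. cost (revealed I k) e * virtual I k e) 1) e
      = marginal (priority I) (arrived I k) (excess (util I) (load k) 1) e"
    using e by (intro marginal_cong excess_cong) (auto simp: priority_revealed revealed_agree)
  then have "truncated (revealed I k) (virtual I k) e = virtual I k e
      - marginal (priority I) (arrived I k) (excess (util I) (load k) 1) e / cost I e"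
    using e by (simp add: truncated_def ground_revealed revealed_agree)
  finally show ?thesis .
qed

lemma cost_allocation:
  assumes k: "k \<le> num_parts" and e: "e \<in> arrived I k"
  shows "cost I e * allocation policy I k e
    = load k e - marginal (priority I) (arrived I k) (excess (util I) (load k) 1) e"
proof -
  have "cost I e \<noteq> 0" using cost_pos[of e] arrived_sub e by force
  then show ?thesis by (simp add: allocation_eq[OF k e] right_diff_distrib)
qed

lemma allocation_bounds:
  assumes k: "k \<le> num_parts"
  shows "0 \<le> allocation policy I k e" "allocation policy I k e \<le> virtual I k e"
proof -
  have "0 \<le> allocation policy I k e \<and> allocation policy I k e \<le> virtual I k e"
  proof (cases "e \<in> arrived I k")
    case True
    then have e: "e \<in> ground I" using arrived_sub by blast
    let ?m = "marginal (priority I) (arrived I k) (excess (util I) (load k) 1) e"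
    have m: "0 \<le> ?m" "?m \<le> load k e"
      using load_nonneg[OF k e] True
      by (auto intro!: marginal_excess_bounds[OF arrived_sub] priority_refl)
    then have "?m / cost I e \<le> virtual I k e" "0 \<le> ?m / cost I e"
      using cost_pos[OF e] by (auto simp: divide_le_eq mult.commute)
    then show ?thesis by (simp add: allocation_eq[OF k True])
  next
    case False
    then show ?thesis using virtual_nonneg[OF k] by (simp add: allocation_def)
  qed
  then show "0 \<le> allocation policy I k e" "allocation policy I k e \<le> virtual I k e" by auto
qed

lemma allocation_feasible:
  assumes k: "k \<le> num_parts"
  shows "feasible I (allocation policy I k)"
  unfolding feasible_def
proof (intro conjI ballI allI impI)
  show "0 \<le> allocation policy I k e" for e using allocation_bounds[OF k] by blast
next
  fix Q assume "Q \<in> set (parts I)"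
  then obtain i where i: "i < num_parts" "Q = batch i" by (auto simp: in_set_conv_nth)
  have "sum (allocation policy I k) Q \<le> sum (virtual I k) Q"
    using allocation_bounds[OF k] by (intro sum_mono) auto
  also have "\<dots> = (\<Sum>e\<in>Q. if i < k then answer i e else 0)"
    using i k by (intro sum.cong) (auto simp: virtual_batch)
  also have "\<dots> \<le> 1"
    using answer_mem[OF i(1)] i(2) by (cases "i < k") (auto simp: subdistributions_def)
  finally show "sum (allocation policy I k) Q \<le> 1" .
next
  fix S assume S: "S \<subseteq> ground I"
  let ?A = "arrived I k" and ?R = "priority I" and ?M = "excess (util I) (load k) 1"
  let ?S = "S \<inter> ?A"
  have fin: "finite ?S" using S by (intro finite_sub) auto
  have "(\<Sum>e\<in>S. cost I e * allocation policy I k e) = (\<Sum>e\<in>?S. cost I e * allocation policy I k e)"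
    using S by (intro sum.mono_neutral_right finite_sub) (auto simp: allocation_def)
  also have "\<dots> = (\<Sum>e\<in>?S. load k e - marginal ?R ?A ?M e)"
    using k by (intro sum.cong) (auto simp: cost_allocation)
  \<comment> \<open>Within the smaller set \<open>?S\<close> less is removed, and the marginals now
    telescope.\<close>
  also have "\<dots> \<le> (\<Sum>e\<in>?S. load k e - marginal ?R ?S ?M e)"
    using arrived_sub
    by (intro sum_mono diff_left_mono marginal_excess_mono priority_refl) auto
  also have "\<dots> = sum (load k) ?S - ?M ?S"
    using sum_marginal[OF linear_order_priority fin] f_empty by (simp add: sum_subtractf)
  \<comment> \<open>\<open>?S\<close> itself competes in the excess at scale 1.\<close>
  also have "\<dots> \<le> util I ?S"
    using excess_ge[OF fin, of ?S "load k" 1 "util I"] by simp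
  also have "\<dots> \<le> util I S" using S by (intro f_mono) auto
  finally show "(\<Sum>e\<in>S. cost I e * allocation policy I k e) \<le> util I S" .
qed

text \<open>The loads of arrived elements stay fixed while their marginals grow with the arrived
  set, so more is truncated.\<close>

lemma allocation_decreasing:
  assumes j: "j < num_parts" and e: "e \<in> arrived I j"
  shows "allocation policy I (Suc j) e \<le> allocation policy I j e"
proof -
  let ?R = "priority I"
  have sub: "arrived I j \<subseteq> arrived I (Suc j)" by (rule arrived_mono) simp
  have "marginal ?R (arrived I j) (excess (util I) (load j) 1) e
      = marginal ?R (arrived I j) (excess (util I) (load (Suc j)) 1) e"
    using j virtual_arrived[of j "Suc j"] by (intro marginal_cong excess_cong refl) auto
  also have "\<dots> \<le> marginal ?R (arrived I (Suc j)) (excess (util I) (load (Suc j)) 1) e"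
    using sub e arrived_sub by (intro marginal_excess_mono priority_refl) auto
  finally have "marginal ?R (arrived I j) (excess (util I) (load j) 1) e / cost I e
      \<le> marginal ?R (arrived I (Suc j)) (excess (util I) (load (Suc j)) 1) e / cost I e"
    using cost_pos[of e] e arrived_sub by (intro divide_right_mono) (auto intro: less_imp_le)
  then show ?thesis
    using allocation_eq[of j e] allocation_eq[of "Suc j" e] virtual_arrived[of j "Suc j" e] j e sub
    by auto
qed

section \<open>Competitiveness\<close>

text \<open>The inequalities of the single parts are summed over the arrivals and \<open>s\<close>
  is sent to 0; the layer-cake formula turns the resulting sum over superlevel sets into the value
  of the truncation.\<close>

lemma competitive_bound:
  assumes x: "feasible I x"
  shows "(1 - 1 / exp 1) * objective I x \<le> objective I (allocation policy I num_parts)"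
proof -
  \<comment> \<open>The densities that occur serve as levels, so the integral over superlevel sets
    is a finite sum with weights \<open>c\<close>.\<close>
  define D where "D = dens I ` ground I"
  have finD: "finite D" using finite_E by (simp add: D_def)
  obtain c where c: "\<And>d. d \<in> D \<Longrightarrow> 0 \<le> c d"
    and c_sum: "\<And>r. r \<in> D \<Longrightarrow> (\<Sum>d | d \<in> D \<and> d \<le> r. c d) = r"
  proof -
    have "0 \<le> d" if "d \<in> D" for d using that dens_nonneg by (auto simp: D_def)
    then show ?thesis using layer_weights_exist[OF finD] that by blast
  qed
  define L where "L = (\<lambda>d. {e \<in> ground I. d \<le> dens I e})"
  have L: "L d \<subseteq> ground I" for d by (auto simp: L_def)
  define P where "P = (\<lambda>y. \<Sum>d\<in>D. c d * smoothed (util I) y (L d))"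
  have layers: "(\<Sum>e\<in>A. dens I e * marginal (priority I) A \<phi> e)
      = (\<Sum>d\<in>D. c d * \<phi> (L d \<inter> A))" if "A \<subseteq> ground I" "\<phi> {} = 0" for A \<phi>
  proof -
    have "(\<Sum>e\<in>A. dens I e * marginal (priority I) A \<phi> e)
        = (\<Sum>d\<in>D. c d * \<phi> {e \<in> A. d \<le> dens I e})"
    proof (rule sum_marginal_layers[OF linear_order_priority])
      show "dens I b \<le> dens I a" if "(a, b) \<in> priority I" for a b
        using that by (auto simp: priority_def)
      show "(\<Sum>d | d \<in> D \<and> d \<le> dens I e. c d) = dens I e" if "e \<in> A" for e
        using that \<open>A \<subseteq> ground I\<close> by (intro c_sum) (auto simp: D_def)
    qed (use that finD in \<open>auto intro: finite_sub\<close>)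
    moreover have "{e \<in> A. d \<le> dens I e} = L d \<inter> A" for d using that by (auto simp: L_def)
    ultimately show ?thesis by simp
  qed
  have potential_eq: "potential (revealed I k) w' = P w"
    if k: "\<And>e. e \<notin> arrived I k \<Longrightarrow> w e = 0" "\<And>e. e \<in> arrived I k \<Longrightarrow> w' e = w e" for k w w'
  proof -
    let ?A = "arrived I k"
    have "potential (revealed I k) w'
        = (\<Sum>e\<in>?A. dens I e * marginal (priority I) ?A (smoothed (util I) w) e)"
      unfolding potential_def ground_revealed
      by (intro sum.cong refl arg_cong2[where f = times] marginal_cong smoothed_cong)
        (auto simp: revealed_agree priority_revealed k(2))
    also have "\<dots> = (\<Sum>d\<in>D. c d * smoothed (util I) w (L d \<inter> ?A))"
      using arrived_sub f_empty by (intro layers) (auto simp: smoothed_empty)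
    also have "\<dots> = P w"
      unfolding P_def using L k(1) by (intro sum.cong refl arg_cong2[where f = times] smoothed_support) auto
    finally show ?thesis .
  qed
  have x_mem: "(\<lambda>e. if e \<in> batch j then x e else 0) \<in> subdistributions (batch j)"
    if "j < num_parts" for j
    using x that batch_sub[OF that] by (auto simp: subdistributions_def feasible_def)
  let ?Y = "load num_parts"
  \<comment> \<open>Induction over the arrivals: \<open>P (load k)\<close> collects the increments
    of potential, and the quotient collects the effect of moving the final load by \<open>s\<close>
    times the load of \<open>x\<close> on arrived elements.\<close>
  have gain: "(\<Sum>e\<in>arrived I k. val I e * x e) \<le> (\<Sum>e\<in>arrived I k. val I e * virtual I num_parts e)
      - P (load k) + (P (\<lambda>e. ?Y e + s * (if e \<in> arrived I k then cost I e * x e else 0)) - P ?Y) / s"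
    if s: "0 < s" "s \<le> 1" and "k \<le> num_parts" for s k
    using \<open>k \<le> num_parts\<close>
  proof (induction k)
    case 0
    have "smoothed (util I) (load 0) (L d) = 0" for d
    proof (rule smoothed_null)
      show "0 \<le> util I S" if "S \<subseteq> L d" for S using that L by (intro f_nonneg) blast
    qed (use L f_empty finite_sub in auto)
    then have "P (load 0) = 0" by (simp add: P_def)
    then show ?case by (simp add: arrived_def)
  next
    case (Suc k)
    then have k: "k < num_parts" by simp
    \<comment> \<open>Adding \<open>s\<close> times the load of \<open>x\<close> on
      \<open>batch k\<close> turns \<open>W k\<close> into \<open>W (Suc k)\<close>, so the
      differences of \<open>P\<close> telescope.\<close>
    define W where "W = (\<lambda>k e. ?Y e + s * (if e \<in> arrived I k then cost I e * x e else 0))"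
    define z where "z = (\<lambda>e. if e \<in> batch k then x e else 0)"
    have step_surplus: "surplus (revealed I (Suc k)) (batch k) (virtual I k) x'
        = (\<Sum>e\<in>batch k. val I e * x' e) - P (\<lambda>e. cost I e * (virtual I k e + x' e))"
      if x': "x' \<in> subdistributions (batch k)" for x'
    proof -
      have "virtual I k e = 0 \<and> x' e = 0" if "e \<notin> arrived I (Suc k)" for e
        using that virtual_not_arrived[of k e] x' k arrived_Suc[OF k] by (auto simp: subdistributions_def)
      then have "potential (revealed I (Suc k)) (\<lambda>e. cost (revealed I (Suc k)) e * (virtual I k e + x' e))
          = P (\<lambda>e. cost I e * (virtual I k e + x' e))"
        by (intro potential_eq) (auto simp: revealed_agree)
      moreover have "(\<Sum>e\<in>batch k. val (revealed I (Suc k)) e * x' e) = (\<Sum>e\<in>batch k. val I e * x' e)"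
        using arrived_Suc[OF k] by (intro sum.cong) (auto simp: revealed_agree)
      ultimately show ?thesis by (simp add: surplus_def)
    qed
    have "(\<Sum>e\<in>batch k. val I e * z e) \<le> (\<Sum>e\<in>batch k. val I e * answer k e)
        - (P (\<lambda>e. cost I e * (virtual I k e + answer k e)) - P (load k))
        + (P (\<lambda>e. W k e + s * (cost I e * z e)) - P (W k)) / s"
    proof (rule best_response_gain[where D = D and c = c and L = L])
      show "answer k \<in> subdistributions (batch k)" by (rule answer_mem[OF k])
      show "z \<in> subdistributions (batch k)" unfolding z_def by (rule x_mem[OF k])
      show "(\<Sum>e\<in>batch k. val I e * x' e) - P (\<lambda>e. cost I e * (virtual I k e + x' e))
          \<le> (\<Sum>e\<in>batch k. val I e * answer k e) - P (\<lambda>e. cost I e * (virtual I k e + answer k e))"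
        if "x' \<in> subdistributions (batch k)" for x'
        using answer_optimal[OF k that] step_surplus[OF that] step_surplus[OF answer_mem[OF k]] by simp
      \<comment> \<open>Virtual fractions are never revised, so the load after this round is at most
        the final load, which is at most \<open>W k\<close>.\<close>
      show "cost I e * (virtual I k e + answer k e) \<le> W k e" if e: "e \<in> ground I" for e
      proof -
        have "virtual I (Suc k) e \<le> virtual I num_parts e"
          using virtual_arrived[of "Suc k" num_parts e] virtual_not_arrived[of "Suc k" e]
            virtual_nonneg[of num_parts e] k by (cases "e \<in> arrived I (Suc k)") auto
        then have "cost I e * (virtual I k e + answer k e) \<le> ?Y e"
          using cost_pos[OF e] by (simp add: mult_left_mono)
        moreover have "0 \<le> s * (if e \<in> arrived I k then cost I e * x e else 0)"
          using s cost_pos[OF e] x e by (auto simp: feasible_def)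
        ultimately show ?thesis by (simp add: W_def)
      qed
    qed (use c L s cost_pos in \<open>auto simp: P_def intro: less_imp_le\<close>)
    moreover have "(\<lambda>e. W k e + s * (cost I e * z e)) = W (Suc k)"
      using arrived_Suc[OF k] arrived_batch_disjoint[OF k] by (auto simp: W_def z_def fun_eq_iff)
    moreover have "(\<Sum>e\<in>batch k. val I e * z e) = (\<Sum>e\<in>batch k. val I e * x e)"
      by (intro sum.cong) (auto simp: z_def)
    moreover have "(\<Sum>e\<in>batch k. val I e * answer k e) = (\<Sum>e\<in>batch k. val I e * virtual I num_parts e)"
      using k by (intro sum.cong) (auto simp: virtual_batch)
    moreover have split: "(\<Sum>e\<in>arrived I (Suc k). g e) = (\<Sum>e\<in>arrived I k. g e) + (\<Sum>e\<in>batch k. g e)"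
      for g :: "'e \<Rightarrow> real"
      unfolding arrived_Suc[OF k]
      using arrived_batch_disjoint[OF k] arrived_sub batch_sub[OF k]
      by (intro sum.union_disjoint finite_sub) auto
    moreover have "(\<Sum>e\<in>arrived I k. val I e * x e) \<le> (\<Sum>e\<in>arrived I k. val I e * virtual I num_parts e)
      - P (load k) + (P (W k) - P ?Y) / s"
      using Suc by (simp add: W_def)
    ultimately have "(\<Sum>e\<in>arrived I (Suc k). val I e * x e)
        \<le> (\<Sum>e\<in>arrived I (Suc k). val I e * virtual I num_parts e)
        - P (load (Suc k)) + (P (W (Suc k)) - P ?Y) / s"
      by (simp add: diff_divide_distrib)
    then show ?case by (simp add: W_def)
  qed
  have val: "val I e = dens I e * cost I e" if "e \<in> ground I" for e
    using cost_pos[OF that] by (simp add: dens_def)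
  \<comment> \<open>Marginals of a modular function are its single values, so the layer-cake formula
    applies to the load itself.\<close>
  have sum_Y: "(\<Sum>e\<in>ground I. dens I e * ?Y e) = (\<Sum>d\<in>D. c d * sum ?Y (L d))"
  proof -
    have "(\<Sum>e\<in>ground I. dens I e * ?Y e)
        = (\<Sum>e\<in>ground I. dens I e * marginal (priority I) (ground I) (sum ?Y) e)"
      using finite_E by (intro sum.cong refl) (simp add: marginal_sum priority_refl)
    also have "\<dots> = (\<Sum>d\<in>D. c d * sum ?Y (L d \<inter> ground I))" by (rule layers) auto
    finally show ?thesis using L by (simp add: Int_absorb2)
  qed
  let ?z = "\<lambda>e. if e \<in> ground I then cost I e * x e else 0"
  have "(1 - 1 / exp 1) * objective I x
      \<le> (\<Sum>d\<in>D. c d * (sum ?Y (L d) - excess (util I) ?Y 1 (L d)))"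
  proof (rule smoothed_limit_bound[OF finD c L])
    show "P y = (\<Sum>d\<in>D. c d * smoothed (util I) y (L d))" for y by (simp add: P_def)
    show "sum ?z S \<le> util I S" if S: "S \<subseteq> ground I" for S
    proof -
      have "sum ?z S = (\<Sum>e\<in>S. cost I e * x e)" using S by (intro sum.cong) auto
      then show ?thesis using x S by (simp add: feasible_def)
    qed
    show "0 \<le> ?Y e" if "e \<in> ground I" for e by (rule load_nonneg[OF order_refl that])
    fix s :: real assume s: "0 < s" "s \<le> 1"
    have "(\<Sum>e\<in>ground I. val I e * virtual I num_parts e) = (\<Sum>e\<in>ground I. dens I e * ?Y e)"
      by (intro sum.cong refl) (simp add: val)
    then show "objective I x
        \<le> (\<Sum>d\<in>D. c d * sum ?Y (L d)) - P ?Y + (P (\<lambda>e. ?Y e + s * ?z e) - P ?Y) / s"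
      using gain[OF s order_refl] unfolding arrived_all objective_def sum_Y by simp
  qed
  \<comment> \<open>The layer-cake formula read backwards: the sum over layers becomes a greedy sum,
    whose terms are those of the truncation.\<close>
  also have "\<dots> = (\<Sum>e\<in>ground I. dens I e * ?Y e)
      - (\<Sum>e\<in>ground I. dens I e * marginal (priority I) (ground I) (excess (util I) ?Y 1) e)"
  proof -
    have "(\<Sum>e\<in>ground I. dens I e * marginal (priority I) (ground I) (excess (util I) ?Y 1) e)
        = (\<Sum>d\<in>D. c d * excess (util I) ?Y 1 (L d \<inter> ground I))"
      using f_empty by (intro layers) auto
    then show ?thesis
      using L by (simp add: sum_Y Int_absorb2 right_diff_distrib sum_subtractf)
  qed
  also have "\<dots> = objective I (allocation policy I num_parts)"
  proof -
    have "val I e * allocation policy I num_parts e = dens I e * ?Y e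
        - dens I e * marginal (priority I) (ground I) (excess (util I) ?Y 1) e" if e: "e \<in> ground I" for e
    proof -
      have "val I e * allocation policy I num_parts e
          = dens I e * (cost I e * allocation policy I num_parts e)"
        using val[OF e] by simp
      also have "cost I e * allocation policy I num_parts e
          = ?Y e - marginal (priority I) (ground I) (excess (util I) ?Y 1) e"
        using cost_allocation[of num_parts e] e by (simp add: arrived_all)
      finally show ?thesis by (simp add: right_diff_distrib)
    qed
    then show ?thesis by (simp add: objective_def sum_subtractf)
  qed
  finally show ?thesis .
qed

end

theorem theorem1p1:
  shows "\<exists>A :: 'e sap_policy. online_algorithm A \<and> competitive (1 - 1 / exp 1) A"
proof (intro exI[of _ policy] conjI)
  show "online_algorithm (policy :: 'e sap_policy)"
    unfolding online_algorithm_def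
    using sap.allocation_feasible sap.allocation_decreasing by (auto simp: sap_def)
  show "competitive (1 - 1 / exp 1) (policy :: 'e sap_policy)"
    unfolding competitive_def
  proof (intro allI impI)
    fix I :: "'e sap" assume I: "sap_instance I"
    obtain x where "feasible I x" "objective I x = OPT I" by (rule OPT_attained[OF I])
    then show "(1 - 1 / exp 1) * OPT I \<le> objective I (allocation policy I (length (parts I)))"
      using sap.competitive_bound[of I x] I by (simp add: sap_def)
  qed
qed

end
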